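(* Let $d\ge 1$ and $T\ge 1$ be integers and let $x_1,\dots,x_T\in\mathbb{R}^d_+\setminus\{0\}$ be arbitrary. Let $\lambda,\mu>0$ satisfy $\lambda\ge 2e$ and $$\frac1\lambda\Big(1+\frac{2\mu}{\lambda}\Big)^2\le\min\Big\{\frac14,\ \frac{5\mu}{8(1+\lambda)}\Big\}.$$ Let $w_{1:T}$ be the sequence of portfolios given by $w_t=\operatorname{argmin}_{w\in\Delta_d}P_{t-1}(w)$ for $t=1,\dots,T$ (the algorithm VB-FTRL with parameters $\lambda,\mu$). Then $$\mathscr{R}_T(w_{1:T}|x_{1:T})\le(\lambda+2\mu)(d-1)\log(T+\lambda d).$$ In particular, with $\lambda=16$ and $\mu=7$ one has $$\mathscr{R}_T(w_{1:T}|x_{1:T})\le 30\,(d-1)\log(T+16d).$$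
   Context: $\Delta_d=\{w\in\mathbb{R}^d_+:\sum_i w[i]=1\}$ is the standard simplex, where $w[i]$ is the $i$-th entry of $w$; $\mathbb{R}^d_+$ and $\mathbb{R}^d_{++}$ are the nonnegative and positive orthants. For $t\in[T]=\{1,\dots,T\}$ let $\ell_t(w)=-\log(x_t^\top w)$ (with $-\log 0=+\infty$). The regret is $$\mathscr{R}_T(w_{1:T}|x_{1:T})=\sum_{t\in[T]}\ell_t(w_t)-\min_{w\in\Delta_d}\sum_{t\in[T]}\ell_t(w).$$ For $w\in\mathbb{R}^d_{++}$ and $t\in\{0,1,\dots,T\}$ define $R(w)=-\sum_{i=1}^d\log(w[i])$, $$L_t(w)=\sum_{\tau=1}^t\ell_\tau(w)+\lambda R(w),\qquad V_t(w)=\tfrac12\log\det\big(A^\top\nabla^2L_t(w)A\big),\qquad P_t(w)=L_t(w)+\mu V_t(w),$$ and set all of $R,L_t,V_t,P_t$ equal to $+\infty$ outside $\mathbb{R}^d_{++}$. Here $A\in\mathbb{R}^{d\times(d-1)}$ is the matrix whose first $d-1$ rows form the identity matrix $I_{d-1}$ and whose last row is $-(1,\dots,1)$. The minimizer of $P_{t-1}$ over $\Delta_d$ exists and is unique. For $d=1$ the simplex is the single point $1$ and the algorithm plays $w_t=1$. *)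

theory Defs
  imports
    "HOL-Analysis.Analysis"
    "Jordan_Normal_Form.Determinant"
begin

text \<open>
  Vectors of \<open>\<real>\<^sup>d\<close> are the elements of \<open>carrier_vec d\<close> and are indexed from 0, so that the
  \<open>d \<times> (d - 1)\<close> matrix \<open>A\<close> and the case \<open>d = 1\<close> need no special treatment (the determinant of the
  \<open>0 \<times> 0\<close> matrix is 1). Names are qualified where HOL-Analysis has a homonym.
\<close>

definition nonneg_orthant :: "nat \<Rightarrow> real Matrix.vec set" where
  "nonneg_orthant d = {w \<in> carrier_vec d. \<forall>i<d. 0 \<le> vec_index w i}"

definition pos_orthant :: "nat \<Rightarrow> real Matrix.vec set" where
  "pos_orthant d = {w \<in> carrier_vec d. \<forall>i<d. 0 < vec_index w i}"

definition std_simplex :: "nat \<Rightarrow> real Matrix.vec set" where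
  "std_simplex d = {w \<in> nonneg_orthant d. (\<Sum>i<d. vec_index w i) = 1}"

definition log_loss :: "real Matrix.vec \<Rightarrow> real Matrix.vec \<Rightarrow> ereal" where
  "log_loss x w = (if scalar_prod x w > 0 then ereal (- ln (scalar_prod x w)) else \<infinity>)"

text \<open>
  The infimum is a minimum: the total loss is a lower semicontinuous function on the compact simplex.
  It is finite when all \<open>x t\<close> are nonnegative and nonzero, so the extended subtraction is the usual one.
\<close>

definition regret ::
  "nat \<Rightarrow> nat \<Rightarrow> (nat \<Rightarrow> real Matrix.vec) \<Rightarrow> (nat \<Rightarrow> real Matrix.vec) \<Rightarrow> ereal" where
  "regret d T w x =
     (\<Sum>t\<in>{1..T}. log_loss (x t) (w t)) - (INF u\<in>std_simplex d. \<Sum>t\<in>{1..T}. log_loss (x t) u)"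

definition partial_deriv :: "nat \<Rightarrow> (real Matrix.vec \<Rightarrow> real) \<Rightarrow> real Matrix.vec \<Rightarrow> real" where
  "partial_deriv i f w = deriv (\<lambda>s. f (w + s \<cdot>\<^sub>v unit_vec (dim_vec w) i)) 0"

definition hessian :: "(real Matrix.vec \<Rightarrow> real) \<Rightarrow> real Matrix.vec \<Rightarrow> real Matrix.mat" where
  "hessian f w =
     Matrix.mat (dim_vec w) (dim_vec w) (\<lambda>(i, j). partial_deriv i (partial_deriv j f) w)"

text \<open>
  \<open>log_barrier\<close>, \<open>reg_loss\<close> and \<open>vol_barrier\<close> (\<open>R\<close>, \<open>L\<^sub>t\<close> and \<open>V\<^sub>t\<close>) are real-valued and are meant only
  on the open positive orthant, where all portfolio returns are positive; the convention that they
  are \<open>\<infinity>\<close> elsewhere enters in \<open>potential\<close> (\<open>P\<^sub>t\<close>), the only one that is ever minimized.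
\<close>

definition log_barrier :: "nat \<Rightarrow> real Matrix.vec \<Rightarrow> real" where
  "log_barrier d w = - (\<Sum>i<d. ln (vec_index w i))"

definition reg_loss ::
  "nat \<Rightarrow> real \<Rightarrow> (nat \<Rightarrow> real Matrix.vec) \<Rightarrow> nat \<Rightarrow> real Matrix.vec \<Rightarrow> real" where
  "reg_loss d lam x t w = (\<Sum>\<tau>\<in>{1..t}. - ln (scalar_prod (x \<tau>) w)) + lam * log_barrier d w"

definition simplex_basis :: "nat \<Rightarrow> real Matrix.mat" where
  "simplex_basis d =
     Matrix.mat d (d - 1) (\<lambda>(i, j). if i = d - 1 then - 1 else if i = j then 1 else 0)"

definition vol_barrier ::
  "nat \<Rightarrow> real \<Rightarrow> (nat \<Rightarrow> real Matrix.vec) \<Rightarrow> nat \<Rightarrow> real Matrix.vec \<Rightarrow> real" where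
  "vol_barrier d lam x t w =
     1 / 2 * ln (Determinant.det
       (transpose_mat (simplex_basis d) * hessian (reg_loss d lam x t) w * simplex_basis d))"

definition potential ::
  "nat \<Rightarrow> real \<Rightarrow> real \<Rightarrow> (nat \<Rightarrow> real Matrix.vec) \<Rightarrow> nat \<Rightarrow> real Matrix.vec \<Rightarrow> ereal" where
  "potential d lam mu x t w =
     (if w \<in> pos_orthant d then ereal (reg_loss d lam x t w + mu * vol_barrier d lam x t w) else \<infinity>)"

definition vb_ftrl ::
  "nat \<Rightarrow> nat \<Rightarrow> real \<Rightarrow> real \<Rightarrow> (nat \<Rightarrow> real Matrix.vec) \<Rightarrow> (nat \<Rightarrow> real Matrix.vec) \<Rightarrow> bool" where
  "vb_ftrl d T lam mu x w \<longleftrightarrow>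
     (\<forall>t\<in>{1..T}. is_arg_min (potential d lam mu x (t - 1)) (\<lambda>u. u \<in> std_simplex d) (w t))"

end

theory Submission
  imports Defs
begin

text \<open>
  Put \<open>n = d - 1\<close>. On the open simplex \<open>L\<^sub>t\<close> is a weighted sum \<open>\<Sum>\<^sub>k c\<^sub>k (- ln (a\<^sub>k \<cdot> w))\<close> over linear forms
  \<open>a\<^sub>k\<close>: the return vectors seen so far, with weight \<open>1\<close>, and the \<open>d\<close> coordinates, with weight \<open>\<lambda>\<close>.
  If \<open>b\<^sub>k\<close> denotes \<open>a\<^sub>k\<close> restricted to the hyperplane of vectors with sum \<open>0\<close>, then \<open>V\<^sub>t = 1/2 ln D\<^sub>t\<close> where
  \<open>D\<^sub>t(w) = det (\<Sum>\<^sub>k c\<^sub>k (a\<^sub>k \<cdot> w)\<^sup>-\<^sup>2 b\<^sub>k b\<^sub>k\<^sup>T)\<close>.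

  Two facts about this determinant carry the proof. By the Cauchy-Binet formula
  (\<open>gram_det_Cauchy_Binet\<close>) it is a combination, with nonnegative coefficients, of products of the
  numbers \<open>(a\<^sub>k \<cdot> w)\<^sup>-\<^sup>2\<close>. Hence it can only grow when a form is added, and \<open>ln D\<^sub>t\<close> is a log-sum-exp of
  convex functions, so \<open>V\<^sub>t\<close> is convex (\<open>ln_vol_det_convex\<close>). Second, adding a vector \<open>b\<close> with
  weight \<open>y\<close> to a Gram matrix \<open>M\<close> multiplies the determinant by at least
  \<open>1 + y (b \<cdot> h)\<^sup>2 / (h\<^sup>T M h)\<close> for every direction \<open>h\<close>
  (\<open>gram_det_insert_lower\<close>).

  One round (\<open>stability\<close>). Let \<open>v = w\<^sub>t\<close> minimize \<open>P\<^sub>t\<^sub>-\<^sub>1\<close>, let \<open>w\<close> be any point of the open simplex,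
  let \<open>r\<^sub>k = a\<^sub>k \<cdot> w / a\<^sub>k \<cdot> v\<close>, and let \<open>r\<close> be this ratio for the new form \<open>x\<^sub>t\<close>. The claim is
  \<open>P\<^sub>t\<^sub>-\<^sub>1(v) + \<ell>\<^sub>t(v) \<le> P\<^sub>t(w)\<close>, that is, \<open>ln r \<le> P\<^sub>t\<^sub>-\<^sub>1(w) - P\<^sub>t\<^sub>-\<^sub>1(v) + \<mu>/2 ln (D\<^sub>t(w) / D\<^sub>t\<^sub>-\<^sub>1(w))\<close>.
  As \<open>V\<^sub>t\<^sub>-\<^sub>1\<close> is convex and \<open>v\<close> is a minimizer, \<open>P\<^sub>t\<^sub>-\<^sub>1(w) - P\<^sub>t\<^sub>-\<^sub>1(v)\<close> is at least the Bregman divergence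
  \<open>B = \<Sum>\<^sub>k c\<^sub>k (r\<^sub>k - 1 - ln r\<^sub>k)\<close> of \<open>L\<^sub>t\<^sub>-\<^sub>1\<close> (\<open>minimizer_gap\<close>). The direction \<open>h = w - v\<close> bounds the ratio
  of determinants from below by \<open>1 + (1 - 1/r)\<^sup>2 / N\<close> with \<open>N = \<Sum>\<^sub>k c\<^sub>k (1 - 1/r\<^sub>k)\<^sup>2\<close>. Only the case
  \<open>B < ln r\<close> is left. The barrier has weight \<open>\<lambda>\<close>, so then all \<open>r\<^sub>k\<close> are bounded below by a number
  close to \<open>1\<close>, and \<open>N\<close> is at most a little more than \<open>2 B\<close>. The right-hand side is thus about
  \<open>B + \<mu> (1 - 1/r)\<^sup>2 / (4 B) \<ge> \<surd>\<mu> (1 - 1/r)\<close>, while \<open>ln r\<close> is about \<open>1 - 1/r\<close>; the conditions on \<open>\<lambda>\<close> and \<open>\<mu>\<close>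
  leave enough room for the errors (\<open>divergence_log_tradeoff\<close>).

  Applied with \<open>w = w\<^sub>t\<^sub>+\<^sub>1\<close>, and with an arbitrary \<open>u\<close> in the last round, these inequalities telescope to
  \<open>\<Sum>\<^sub>t \<ell>\<^sub>t(w\<^sub>t) \<le> P\<^sub>T(u) - P\<^sub>0(w\<^sub>1)\<close>. For \<open>u\<close> one takes the comparator, moved towards the uniform one by
  the fraction \<open>\<alpha> = \<lambda> n / (T + \<lambda> n)\<close>. This costs at most \<open>\<lambda> n\<close> in the losses, \<open>\<lambda> n ln (1/\<alpha>)\<close> in the barrier
  and \<open>2 \<mu> n ln (T + \<lambda> d)\<close> in the volumetric term (\<open>pot_comparator\<close>).
\<close>

section \<open>Determinants of Gram matrices\<close>

definition gram_det :: "nat \<Rightarrow> 'k set \<Rightarrow> ('k \<Rightarrow> nat \<Rightarrow> real) \<Rightarrow> ('k \<Rightarrow> real) \<Rightarrow> real" where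
  "gram_det n K b y =
     Determinant.det (Matrix.mat n n (\<lambda>(i, j). \<Sum>k\<in>K. y k * (b k i * b k j)))"

text \<open>
  The squared minor of the \<open>n\<close> vectors selected by \<open>f\<close>. The factor \<open>1 / n!\<close> allows the expansion to
  run over all functions \<open>f\<close> instead of all \<open>n\<close>-element sets: functions that are not injective have a
  vanishing minor, and every set is the range of \<open>n!\<close> injective functions.
\<close>

definition cb_weight :: "nat \<Rightarrow> ('k \<Rightarrow> nat \<Rightarrow> real) \<Rightarrow> (nat \<Rightarrow> 'k) \<Rightarrow> real" where
  "cb_weight n b f = (Determinant.det (Matrix.mat n n (\<lambda>(i, j). b (f i) j)))\<^sup>2 / fact n"

lemma cb_weight_nonneg: "0 \<le> cb_weight n b f"
  by (simp add: cb_weight_def)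

lemma permutes_lt: "p permutes {0..<n} \<Longrightarrow> i < n \<Longrightarrow> p i < (n::nat)"
  using permutes_in_image[of p "{0..<n}" i] by simp

text \<open>
  Multilinearity in the rows writes the determinant as a sum over \<open>f\<close> of a product of entries times
  the minor \<open>det (b (f i) j)\<close>. Reindexing this sum by a permutation \<open>p\<close> multiplies the minor by the sign of
  \<open>p\<close>; the average over all \<open>p\<close> turns the product of entries into a second copy of the minor.
\<close>

lemma gram_det_Cauchy_Binet:
  fixes b :: "'k \<Rightarrow> nat \<Rightarrow> real"
  assumes K: "finite K"
  shows "gram_det n K b y = (\<Sum>f\<in>{0..<n} \<rightarrow>\<^sub>E K. cb_weight n b f * (\<Prod>i=0..<n. y (f i)))"
proof -
  define F where "F = ({0..<n} \<rightarrow>\<^sub>E K)"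
  define B where "B f = Matrix.mat n n (\<lambda>(i, j). b (f i) j)" for f :: "nat \<Rightarrow> 'k"
  define S where "S = {p. p permutes {0..<n}}"
  have Bc: "B f \<in> carrier_mat n n" for f by (simp add: B_def)
  have detB: "Determinant.det (B f) = (\<Sum>p\<in>S. signof p * (\<Prod>i=0..<n. b (f i) (p i)))" for f
    unfolding det_def'[OF Bc] S_def
    by (intro sum.cong refl arg_cong2[where f = "(*)"] prod.cong)
       (auto simp: B_def permutes_lt)
  have expand: "gram_det n K b y =
      (\<Sum>f\<in>F. (\<Prod>i=0..<n. y (f i)) * (\<Prod>i=0..<n. b (f i) i) * Determinant.det (B f))"
  proof -
    have "gram_det n K b y =
        (\<Sum>p\<in>S. signof p * (\<Prod>i=0..<n. \<Sum>k\<in>K. y k * (b k i * b k (p i))))"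
      unfolding gram_det_def S_def
      by (subst det_def'[of _ n])
         (auto intro!: sum.cong arg_cong2[where f = "(*)"] prod.cong simp: permutes_lt)
    also have "\<dots> = (\<Sum>p\<in>S. \<Sum>f\<in>F. signof p *
        (\<Prod>i=0..<n. y (f i) * (b (f i) i * b (f i) (p i))))"
      unfolding F_def using K
      by (intro sum.cong refl) (subst prod_sum_PiE, auto simp: sum_distrib_left)
    also have "\<dots> = (\<Sum>f\<in>F. \<Sum>p\<in>S. signof p *
        (\<Prod>i=0..<n. y (f i) * (b (f i) i * b (f i) (p i))))"
      by (rule sum.swap)
    also have "\<dots> = (\<Sum>f\<in>F. (\<Prod>i=0..<n. y (f i)) * (\<Prod>i=0..<n. b (f i) i) * Determinant.det (B f))"
      unfolding detB by (intro sum.cong refl) (simp add: sum_distrib_left prod.distrib mult_ac)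
    finally show ?thesis .
  qed
  have perm: "gram_det n K b y =
      (\<Sum>f\<in>F. (\<Prod>i=0..<n. y (f i)) * Determinant.det (B f) * (signof p * (\<Prod>i=0..<n. b (f (p i)) i)))"
    if p: "p \<in> S" for p
  proof -
    have pp: "p permutes {0..<n}" using p by (simp add: S_def)
    have bij: "bij_betw (\<lambda>f. f \<circ> p) F F"
    proof (rule bij_betw_byWitness[where f' = "\<lambda>f. f \<circ> Hilbert_Choice.inv p"])
      have ip: "Hilbert_Choice.inv p permutes {0..<n}" by (rule permutes_inv[OF pp])
      have "f \<circ> q \<in> F" if "f \<in> F" "q permutes {0..<n}" for f q
        using that permutes_in_image[OF that(2)]
        unfolding F_def PiE_def extensional_def by (auto simp: permutes_def)
      then show "(\<lambda>f. f \<circ> p) ` F \<subseteq> F" "(\<lambda>f. f \<circ> Hilbert_Choice.inv p) ` F \<subseteq> F" using pp ip by blast+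
    qed (auto simp: comp_assoc permutes_inv_o[OF pp])
    have yp: "(\<Prod>i=0..<n. y ((f \<circ> p) i)) = (\<Prod>i=0..<n. y (f i))" for f
      using permutes_imp_bij[OF pp] by (simp add: prod.reindex_bij_betw[of p "{0..<n}" "{0..<n}" "\<lambda>i. y (f i)"])
    have Bp: "Determinant.det (B (f \<circ> p)) = signof p * Determinant.det (B f)" for f
    proof -
      have "B (f \<circ> p) = Matrix.mat n n (\<lambda>(i, j). B f $$ (p i, j))"
        by (rule eq_matI) (auto simp: B_def permutes_lt[OF pp])
      then show ?thesis using det_permute_rows[OF Bc pp] by simp
    qed
    show ?thesis
      unfolding expand sum.reindex_bij_betw[OF bij, symmetric, of
          "\<lambda>f. (\<Prod>i=0..<n. y (f i)) * (\<Prod>i=0..<n. b (f i) i) * Determinant.det (B f)"]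
      by (intro sum.cong refl) (simp only: yp Bp, simp add: mult_ac)
  qed
  have detBT: "(\<Sum>p\<in>S. signof p * (\<Prod>i=0..<n. b (f (p i)) i)) = Determinant.det (B f)" for f
    unfolding mat_det_left_def[OF Bc] S_def
    by (intro sum.cong arg_cong2[where f = "(*)"] prod.cong) (auto simp: B_def permutes_lt)
  have cS: "card S = fact n" unfolding S_def by (subst card_permutations[of _ n]) auto
  have "fact n * gram_det n K b y = (\<Sum>p\<in>S. gram_det n K b y)" by (simp add: cS)
  also have "\<dots> = (\<Sum>p\<in>S. \<Sum>f\<in>F. (\<Prod>i=0..<n. y (f i)) * Determinant.det (B f) *
      (signof p * (\<Prod>i=0..<n. b (f (p i)) i)))"
    by (intro sum.cong refl perm)
  also have "\<dots> = (\<Sum>f\<in>F. \<Sum>p\<in>S. (\<Prod>i=0..<n. y (f i)) * Determinant.det (B f) *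
      (signof p * (\<Prod>i=0..<n. b (f (p i)) i)))"
    by (rule sum.swap)
  also have "\<dots> = (\<Sum>f\<in>F. (Determinant.det (B f))\<^sup>2 * (\<Prod>i=0..<n. y (f i)))"
    unfolding sum_distrib_left[symmetric] detBT by (simp add: power2_eq_square mult_ac)
  finally show ?thesis
    unfolding cb_weight_def F_def B_def
    by (simp add: sum_divide_distrib[symmetric] field_simps)
qed

text \<open>
  This is monotonicity of the determinant on positive semidefinite matrices, for the only kind of
  increment that occurs here: the expansion over the larger index set merely has more nonnegative terms.
\<close>

lemma gram_det_mono:
  assumes "finite K'" "K \<subseteq> K'" "\<And>k. k \<in> K' \<Longrightarrow> 0 \<le> y k"
  shows "gram_det n K b y \<le> gram_det n K' b y"
proof -
  have K: "finite K" using assms by (metis finite_subset)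
  show ?thesis
    unfolding gram_det_Cauchy_Binet[OF K] gram_det_Cauchy_Binet[OF assms(1)]
  proof (rule sum_mono2)
    show "finite ({0..<n} \<rightarrow>\<^sub>E K')" using assms by (intro finite_PiE) auto
    show "{0..<n} \<rightarrow>\<^sub>E K \<subseteq> {0..<n} \<rightarrow>\<^sub>E K'" using assms by (intro PiE_mono) auto
    fix f assume "f \<in> ({0..<n} \<rightarrow>\<^sub>E K') - ({0..<n} \<rightarrow>\<^sub>E K)"
    then show "0 \<le> cb_weight n b f * (\<Prod>i=0..<n. y (f i))"
      using assms(3) by (intro mult_nonneg_nonneg cb_weight_nonneg prod_nonneg) (auto dest: PiE_mem)
  qed
qed

text \<open>
  Both sides are the determinant of the bordered matrix with blocks \<open>1, -g\<^sup>T, p, I\<close>, computed by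
  eliminating the lower left block with row operations and with column operations, respectively.
\<close>

lemma det_one_plus_rank_one:
  fixes p g :: "real Matrix.vec"
  assumes p: "p \<in> carrier_vec n" and g: "g \<in> carrier_vec n"
  shows "Determinant.det (1\<^sub>m n + Matrix.mat n n (\<lambda>(i, j). vec_index p i * vec_index g j)) =
         1 + scalar_prod g p"
proof -
  define P where "P = Matrix.mat n 1 (\<lambda>(i, j). vec_index p i)"
  define G where "G = Matrix.mat 1 n (\<lambda>(i, j). vec_index g j)"
  define Z where "Z = four_block_mat (1\<^sub>m 1) (- G) P (1\<^sub>m n)"
  have [simp]: "P \<in> carrier_mat n 1" "G \<in> carrier_mat 1 n" by (auto simp: P_def G_def)
  then have [simp]: "P * G \<in> carrier_mat n n" by (rule mult_carrier_mat)
  have PG: "P * G = Matrix.mat n n (\<lambda>(i, j). vec_index p i * vec_index g j)"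
    by (rule eq_matI) (auto simp: P_def G_def scalar_prod_def)
  have GP: "G * P = Matrix.mat 1 1 (\<lambda>_. scalar_prod g p)"
    using p g by (intro eq_matI) (auto simp: P_def G_def scalar_prod_def)
  have Zc: "Z \<in> carrier_mat (1 + n) (1 + n)" unfolding Z_def by (rule four_block_carrier_mat) auto
  have lower: "four_block_mat (1\<^sub>m 1) (0\<^sub>m 1 n) X (1\<^sub>m n) \<in> carrier_mat (1 + n) (1 + n)"
    "Determinant.det (four_block_mat (1\<^sub>m 1) (0\<^sub>m 1 n) X (1\<^sub>m n)) = 1"
    if "X \<in> carrier_mat n 1" for X :: "real Matrix.mat"
    using that by (auto intro!: four_block_carrier_mat simp: det_four_block_mat_upper_right_zero[of _ 1 _ n])
  have "four_block_mat (1\<^sub>m 1) (0\<^sub>m 1 n) P (1\<^sub>m n) * four_block_mat (1\<^sub>m 1) (- G) (0\<^sub>m n 1) (1\<^sub>m n + P * G) =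
      four_block_mat (1\<^sub>m 1 * 1\<^sub>m 1 + 0\<^sub>m 1 n * 0\<^sub>m n 1) (1\<^sub>m 1 * - G + 0\<^sub>m 1 n * (1\<^sub>m n + P * G))
        (P * 1\<^sub>m 1 + 1\<^sub>m n * 0\<^sub>m n 1) (P * - G + 1\<^sub>m n * (1\<^sub>m n + P * G))"
    by (rule mult_four_block_mat[where ?n1.0 = 1 and ?n2.0 = n and ?nc1.0 = 1 and ?nc2.0 = n]) (auto simp del: One_nat_def)
  also have "\<dots> = Z"
  proof -
    have "P * - G + 1\<^sub>m n * (1\<^sub>m n + P * G) = 1\<^sub>m n"
      by (intro eq_matI) (auto simp: P_def G_def scalar_prod_def)
    moreover have "1\<^sub>m 1 * - G + 0\<^sub>m 1 n * (1\<^sub>m n + P * G) = - G"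
      by (intro eq_matI) (auto simp: P_def G_def scalar_prod_def)
    moreover have "P * 1\<^sub>m 1 + 1\<^sub>m n * 0\<^sub>m n 1 = P"
      by (intro eq_matI) (auto simp: P_def scalar_prod_def)
    moreover have "1\<^sub>m 1 * 1\<^sub>m 1 + 0\<^sub>m 1 n * 0\<^sub>m n 1 = (1\<^sub>m 1 :: real Matrix.mat)"
      by (intro eq_matI) (auto simp: scalar_prod_def)
    ultimately show ?thesis by (simp only: Z_def)
  qed
  finally have Z1: "four_block_mat (1\<^sub>m 1) (0\<^sub>m 1 n) P (1\<^sub>m n) *
      four_block_mat (1\<^sub>m 1) (- G) (0\<^sub>m n 1) (1\<^sub>m n + P * G) = Z" .
  have "Z * four_block_mat (1\<^sub>m 1) (0\<^sub>m 1 n) (- P) (1\<^sub>m n) =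
      four_block_mat (1\<^sub>m 1 * 1\<^sub>m 1 + - G * - P) (1\<^sub>m 1 * 0\<^sub>m 1 n + - G * 1\<^sub>m n)
        (P * 1\<^sub>m 1 + 1\<^sub>m n * - P) (P * 0\<^sub>m 1 n + 1\<^sub>m n * 1\<^sub>m n)"
    unfolding Z_def by (rule mult_four_block_mat[where ?n1.0 = 1 and ?n2.0 = n and ?nc1.0 = 1 and ?nc2.0 = n]) (auto simp del: One_nat_def)
  also have "\<dots> = four_block_mat (1\<^sub>m 1 + G * P) (- G) (0\<^sub>m n 1) (1\<^sub>m n)"
  proof -
    have "1\<^sub>m 1 * 1\<^sub>m 1 + - G * - P = 1\<^sub>m 1 + G * P"
      by (intro eq_matI) (auto simp: P_def G_def scalar_prod_def)
    moreover have "1\<^sub>m 1 * 0\<^sub>m 1 n + - G * 1\<^sub>m n = - G"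
      by (intro eq_matI) (auto simp: G_def scalar_prod_def)
    moreover have "P * 1\<^sub>m 1 + 1\<^sub>m n * - P = 0\<^sub>m n 1"
      by (intro eq_matI) (auto simp: P_def scalar_prod_def)
    moreover have "P * 0\<^sub>m 1 n + 1\<^sub>m n * 1\<^sub>m n = 1\<^sub>m n"
      by (intro eq_matI) (auto simp: P_def scalar_prod_def)
    ultimately show ?thesis by (simp only:)
  qed
  finally have Z2: "Z * four_block_mat (1\<^sub>m 1) (0\<^sub>m 1 n) (- P) (1\<^sub>m n) =
      four_block_mat (1\<^sub>m 1 + G * P) (- G) (0\<^sub>m n 1) (1\<^sub>m n)" .
  from Z1 Z2 have
    "Determinant.det Z = Determinant.det (four_block_mat (1\<^sub>m 1) (- G) (0\<^sub>m n 1) (1\<^sub>m n + P * G))"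
    "Determinant.det Z = Determinant.det (four_block_mat (1\<^sub>m 1 + G * P) (- G) (0\<^sub>m n 1) (1\<^sub>m n))"
    using lower[of P] lower[of "- P"] Zc
      det_mult[of "four_block_mat (1\<^sub>m 1) (0\<^sub>m 1 n) P (1\<^sub>m n)" "1 + n" "four_block_mat (1\<^sub>m 1) (- G) (0\<^sub>m n 1) (1\<^sub>m n + P * G)"]
      det_mult[OF Zc, of "four_block_mat (1\<^sub>m 1) (0\<^sub>m 1 n) (- P) (1\<^sub>m n)"]
    by (simp_all add: four_block_carrier_mat del: One_nat_def)
  moreover have "Determinant.det (four_block_mat (1\<^sub>m 1) (- G) (0\<^sub>m n 1) (1\<^sub>m n + P * G)) =
      Determinant.det (1\<^sub>m n + P * G)"
    by (subst det_four_block_mat_lower_left_zero[of _ 1 _ n]) (auto simp del: One_nat_def)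
  moreover have "Determinant.det (four_block_mat (1\<^sub>m 1 + G * P) (- G) (0\<^sub>m n 1) (1\<^sub>m n)) = 1 + scalar_prod g p"
    by (subst det_four_block_mat_lower_left_zero[of _ 1 _ n]) (auto simp: GP det_single simp del: One_nat_def)
  ultimately show ?thesis by (simp add: PG)
qed

text \<open>
  Let \<open>M\<close> be the Gram matrix over \<open>K\<close> and let \<open>p\<close> solve \<open>M p = y\<^sub>t b\<^sub>t\<close>. By the matrix determinant lemma
  the new vector multiplies the determinant by \<open>1 + b\<^sub>t \<cdot> p\<close>. Since \<open>y\<^sub>t (b\<^sub>t \<cdot> h) = p\<^sup>T M h\<close>, the
  Cauchy-Schwarz inequality for the form \<open>M\<close> bounds \<open>b\<^sub>t \<cdot> p\<close> from below by \<open>y\<^sub>t (b\<^sub>t \<cdot> h)\<^sup>2 / (h\<^sup>T M h)\<close>. The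
  inequality is stated without division, so that it covers \<open>h\<^sup>T M h = 0\<close>.
\<close>

lemma gram_det_insert_lower:
  fixes b :: "'k \<Rightarrow> nat \<Rightarrow> real" and h :: "nat \<Rightarrow> real"
  assumes K: "finite K" "t \<notin> K" and y: "\<And>k. k \<in> insert t K \<Longrightarrow> 0 \<le> y k"
    and pos: "0 < gram_det n K b y"
  defines "N \<equiv> \<Sum>k\<in>K. y k * (\<Sum>i<n. b k i * h i)\<^sup>2"
  defines "a2 \<equiv> y t * (\<Sum>i<n. b t i * h i)\<^sup>2"
  shows "gram_det n K b y * (N + a2) \<le> gram_det n (insert t K) b y * N"
proof -
  define M where "M = Matrix.mat n n (\<lambda>(i, j). \<Sum>k\<in>K. y k * (b k i * b k j))"
  define g where "g = Matrix.vec n (b t)"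
  have M: "M \<in> carrier_mat n n" and g: "g \<in> carrier_vec n" by (auto simp: M_def g_def)
  have D: "gram_det n K b y = Determinant.det M" by (simp add: gram_det_def M_def)
  obtain Mi where Mi: "Mi \<in> carrier_mat n n" "M * Mi = 1\<^sub>m n"
    using det_non_zero_imp_unit[OF M, of "()"] pos D
    by (auto simp: Units_def ring_mat_def)
  define p where "p = y t \<cdot>\<^sub>v (Mi *\<^sub>v g)"
  have p: "p \<in> carrier_vec n" using Mi g by (simp add: p_def)
  have Mp: "M *\<^sub>v p = y t \<cdot>\<^sub>v g"
    using M Mi g unfolding p_def
    by (simp add: mult_mat_vec[OF M] assoc_mult_mat_vec[OF M Mi(1) g, symmetric])
  have Mpi: "(\<Sum>k\<in>K. y k * b k i * (\<Sum>j<n. b k j * vec_index p j)) = y t * b t i" if "i < n" for i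
  proof -
    have "y t * b t i = vec_index (M *\<^sub>v p) i" using that by (simp add: Mp g_def)
    also have "\<dots> = (\<Sum>j<n. (\<Sum>k\<in>K. y k * (b k i * b k j)) * vec_index p j)"
      using that p M by (simp add: scalar_prod_def M_def lessThan_atLeast0)
    also have "\<dots> = (\<Sum>k\<in>K. y k * b k i * (\<Sum>j<n. b k j * vec_index p j))"
      by (simp add: sum_distrib_left sum_distrib_right mult_ac) (subst sum.swap, simp)
    finally show ?thesis by simp
  qed
  define q where "q k = (\<Sum>j<n. b k j * vec_index p j)" for k
  define z where "z k = (\<Sum>j<n. b k j * h j)" for k
  have form: "(\<Sum>k\<in>K. y k * (\<Sum>i<n. b k i * e i) * q k) = y t * (\<Sum>i<n. b t i * e i)" for e
  proof -
    have "y t * (\<Sum>i<n. b t i * e i) = (\<Sum>i<n. (\<Sum>k\<in>K. y k * b k i * q k) * e i)"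
      using Mpi by (simp add: sum_distrib_left q_def mult.assoc)
    also have "\<dots> = (\<Sum>k\<in>K. y k * (\<Sum>i<n. b k i * e i) * q k)"
      by (simp add: sum_distrib_left sum_distrib_right) (subst sum.swap, simp add: mult_ac)
    finally show ?thesis by simp
  qed
  \<comment> \<open>The numbers \<open>q k\<close> and \<open>z k\<close> represent \<open>p\<close> and \<open>h\<close>; \<open>qq\<close> and \<open>qz\<close> compute \<open>p\<^sup>T M p\<close> and \<open>p\<^sup>T M h\<close>.\<close>
  have qq: "(\<Sum>k\<in>K. y k * (q k)\<^sup>2) = y t * q t"
    using form[of "vec_index p"] by (simp add: q_def power2_eq_square mult.assoc)
  have qz: "(\<Sum>k\<in>K. y k * z k * q k) = y t * z t" using form[of h] by (simp add: z_def)
  have "(\<Sum>k\<in>K. (sqrt (y k) * z k) * (sqrt (y k) * q k))\<^sup>2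
      \<le> (\<Sum>k\<in>K. (sqrt (y k) * z k)\<^sup>2) * (\<Sum>k\<in>K. (sqrt (y k) * q k)\<^sup>2)"
    by (rule Cauchy_Schwarz_ineq_sum)
  moreover have "(\<Sum>k\<in>K. (sqrt (y k) * z k) * (sqrt (y k) * q k)) = (\<Sum>k\<in>K. y k * z k * q k)"
    using y by (intro sum.cong) (auto simp: algebra_simps)
  moreover have "(\<Sum>k\<in>K. (sqrt (y k) * e k)\<^sup>2) = (\<Sum>k\<in>K. y k * (e k)\<^sup>2)" for e
    using y by (intro sum.cong) (auto simp: power_mult_distrib)
  ultimately have CS: "(y t * z t)\<^sup>2 \<le> N * (y t * q t)"
    using qq qz by (simp add: N_def z_def)
  have N0: "0 \<le> N" unfolding N_def using y by (intro sum_nonneg) auto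
  have CS': "y t * (z t)\<^sup>2 \<le> N * q t"
  proof (cases "y t = 0")
    case True
    have "M *\<^sub>v p = 0\<^sub>v n" using Mp True g by auto
    then have "p = 0\<^sub>v n" using True Mi g by (auto simp: p_def)
    then show ?thesis by (simp add: q_def True)
  next
    case False
    then have "0 < y t" using y[of t] by auto
    have "y t * (y t * (z t)\<^sup>2) \<le> y t * (N * q t)" using CS by (simp add: power2_eq_square mult_ac)
    then show ?thesis using \<open>0 < y t\<close> mult_le_cancel_left_pos by blast
  qed
  have "gram_det n (insert t K) b y = Determinant.det (M * (1\<^sub>m n + Matrix.mat n n (\<lambda>(i, j). vec_index p i * vec_index g j)))"
  proof -
    have Mpe: "(\<Sum>l=0..<n. M $$ (i, l) * vec_index p l) = y t * b t i" if "i < n" for i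
    proof -
      have "(\<Sum>l=0..<n. M $$ (i, l) * vec_index p l) = vec_index (M *\<^sub>v p) i"
        using that M p by (simp add: scalar_prod_def)
      then show ?thesis using that g by (simp add: Mp g_def)
    qed
    have *: "M * Matrix.mat n n (\<lambda>(i, j). vec_index p i * vec_index g j) =
        Matrix.mat n n (\<lambda>(i, j). y t * b t i * b t j)"
      using M Mpe
      by (intro eq_matI) (auto simp: scalar_prod_def sum_distrib_right[symmetric] mult.assoc[symmetric] g_def)
    have "M * (1\<^sub>m n + Matrix.mat n n (\<lambda>(i, j). vec_index p i * vec_index g j)) =
       M + Matrix.mat n n (\<lambda>(i, j). y t * b t i * b t j)"
      by (subst mult_add_distrib_mat[OF M, of _ n]) (use M * in auto)
    also have "\<dots> = Matrix.mat n n (\<lambda>(i, j). \<Sum>k\<in>insert t K. y k * (b k i * b k j))"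
      using K by (intro eq_matI) (auto simp: M_def)
    finally show ?thesis by (simp add: gram_det_def)
  qed
  also have "\<dots> = gram_det n K b y * (1 + q t)"
  proof -
    have "scalar_prod g p = q t" using p by (simp add: scalar_prod_def q_def g_def lessThan_atLeast0)
    then show ?thesis
      using det_mult[OF M, of "1\<^sub>m n + Matrix.mat n n (\<lambda>(i, j). vec_index p i * vec_index g j)"]
      by (simp add: det_one_plus_rank_one[OF p g] D)
  qed
  finally have "gram_det n (insert t K) b y * N = gram_det n K b y * (N + N * q t)"
    by (simp add: algebra_simps)
  then show ?thesis using CS' pos by (simp add: a2_def z_def)
qed

lemma det_le_fact_power:
  fixes A :: "real Matrix.mat"
  assumes A: "A \<in> carrier_mat n n" and bd: "\<And>i j. i < n \<Longrightarrow> j < n \<Longrightarrow> \<bar>A $$ (i, j)\<bar> \<le> m"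
  shows "Determinant.det A \<le> fact n * m ^ n"
proof -
  have "Determinant.det A \<le> (\<Sum>p\<in>{p. p permutes {0..<n}}. m ^ n)"
    unfolding det_def'[OF A]
  proof (rule sum_mono)
    fix p assume "p \<in> {p. p permutes {0..<n}}"
    then have p: "p permutes {0..<n}" by simp
    have "signof p * (\<Prod>i=0..<n. A $$ (i, p i)) \<le> \<bar>\<Prod>i=0..<n. A $$ (i, p i)\<bar>"
      by (auto simp: sign_def)
    also have "\<dots> = (\<Prod>i=0..<n. \<bar>A $$ (i, p i)\<bar>)" by (rule abs_prod)
    also have "\<dots> \<le> (\<Prod>i=0..<n. m)" using p bd by (intro prod_mono) (auto simp: permutes_lt)
    finally show "signof p * (\<Prod>i=0..<n. A $$ (i, p i)) \<le> m ^ n" by simp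
  qed
  also have "\<dots> = fact n * m ^ n" by (simp add: card_permutations[of "{0..<n}" n])
  finally show ?thesis .
qed

section \<open>Inequalities for the logarithm\<close>

text \<open>
  This is the Bregman divergence of \<open>- ln\<close>: for positive \<open>s\<close> and \<open>s'\<close> the error of the tangent of \<open>- ln\<close>
  at \<open>s\<close>, evaluated at \<open>s'\<close>, is \<open>log_gap (s' / s)\<close>.
\<close>

definition log_gap :: "real \<Rightarrow> real" where
  "log_gap r = r - 1 - ln r"

lemma log_gap_nonneg: "0 < r \<Longrightarrow> 0 \<le> log_gap r"
  using ln_le_minus_one[of r] by (simp add: log_gap_def)

lemma ln_le_half_diff:
  fixes r :: real
  assumes "1 \<le> r"
  shows "ln r \<le> (r - 1 / r) / 2"
proof -
  let ?f = "\<lambda>x::real. (x - 1 / x) / 2 - ln x"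
  have "?f 1 \<le> ?f r"
  proof (rule DERIV_nonneg_imp_nondecreasing[OF assms])
    fix x :: real assume x: "1 \<le> x" "x \<le> r"
    have "(?f has_real_derivative (1 + 1 / x\<^sup>2) / 2 - 1 / x) (at x)"
      using x by (auto intro!: derivative_eq_intros simp: power2_eq_square)
    moreover have "(1 + 1 / x\<^sup>2) / 2 - 1 / x = (1 - 1 / x)\<^sup>2 / 2"
      using x by (simp add: power2_eq_square field_simps)
    ultimately show "\<exists>y. (?f has_real_derivative y) (at x) \<and> 0 \<le> y" by fastforce
  qed
  then show ?thesis by simp
qed

lemma log_gap_quadratic_lower:
  assumes "0 < r" "r \<le> 1"
  shows "(1 - r)\<^sup>2 \<le> 2 * log_gap r"
proof -
  let ?f = "\<lambda>x::real. 2 * (x - 1 - ln x) - (1 - x)\<^sup>2"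
  have "?f 1 \<le> ?f r"
  proof (rule DERIV_nonpos_imp_nonincreasing[OF assms(2)])
    fix x :: real assume x: "r \<le> x" "x \<le> 1"
    then have "0 < x" using assms by simp
    then have "(?f has_real_derivative 2 * (1 - 1 / x) + 2 * (1 - x)) (at x)"
      by (auto intro!: derivative_eq_intros)
    moreover have "2 * (1 - 1 / x) + 2 * (1 - x) = - (2 * (1 - x)\<^sup>2 / x)"
      using \<open>0 < x\<close> by (simp add: power2_eq_square field_simps)
    moreover have "\<dots> \<le> 0" using \<open>0 < x\<close> by simp
    ultimately show "\<exists>y. (?f has_real_derivative y) (at x) \<and> y \<le> 0" by metis
  qed
  then show ?thesis by (simp add: log_gap_def)
qed

text \<open>
  The square \<open>(1 - 1/r)\<^sup>2\<close> is the squared length of the step from \<open>1\<close> to \<open>r\<close> in the Hessian metric of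
  \<open>- ln\<close> at the end point \<open>r\<close>. It is at most twice the divergence when \<open>r \<ge> 1\<close>, but blows up faster than
  the divergence when \<open>r\<close> tends to \<open>0\<close>; the factor \<open>\<rho>\<^sup>2\<close> compensates for this down to \<open>r = \<rho>\<close>.
\<close>

lemma log_gap_lower_local_norm:
  assumes rho: "0 < rho" "rho \<le> 1" and r: "rho \<le> r"
  shows "rho\<^sup>2 * (1 - 1 / r)\<^sup>2 \<le> 2 * log_gap r"
proof -
  have r0: "0 < r" using rho r by simp
  have eq: "(1 - 1 / r)\<^sup>2 = (1 - r)\<^sup>2 / r\<^sup>2" using r0 by (simp add: power2_eq_square field_simps)
  show ?thesis
  proof (cases "r \<le> 1")
    case True
    have "rho\<^sup>2 \<le> r\<^sup>2" using rho r by (intro power_mono) auto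
    then have "rho\<^sup>2 * ((1 - r)\<^sup>2 / r\<^sup>2) \<le> r\<^sup>2 * ((1 - r)\<^sup>2 / r\<^sup>2)" by (intro mult_right_mono) auto
    then show ?thesis using log_gap_quadratic_lower[OF r0 True] r0 eq by simp
  next
    case False
    have "rho\<^sup>2 * (1 - 1 / r)\<^sup>2 \<le> 1 * (1 - 1 / r)\<^sup>2"
      using rho by (intro mult_right_mono) (auto simp: power_le_one)
    also have "\<dots> \<le> r * (1 - 1 / r)\<^sup>2" using False by (intro mult_right_mono) auto
    also have "\<dots> = 2 * (r - 1 - (r - 1 / r) / 2)" using r0 by (simp add: power2_eq_square field_simps)
    also have "\<dots> \<le> 2 * log_gap r" using ln_le_half_diff[of r] False by (simp add: log_gap_def)
    finally show ?thesis .
  qed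
qed

text \<open>
  Jensen's inequality, followed by an estimate of the weights by \<open>1\<close>. It is used for a portfolio
  return, which is a weighted average of coordinates, so that a large change of one return shows up
  in the barrier.
\<close>

lemma log_gap_average_le:
  assumes I: "finite I" and p: "\<And>i. i \<in> I \<Longrightarrow> 0 \<le> p i" "sum p I = 1" and r: "\<And>i. i \<in> I \<Longrightarrow> 0 < r i"
    and avg: "q = (\<Sum>i\<in>I. p i * r i)" "0 < q"
  shows "log_gap q \<le> (\<Sum>i\<in>I. log_gap (r i))"
proof -
  have p1: "p i \<le> 1" if "i \<in> I" for i
    using member_le_sum[of i I p] that I p by auto
  have "log_gap q = (\<Sum>i\<in>I. p i * (log_gap q + (1 - 1 / q) * (r i - q)))"
  proof -
    have "(\<Sum>i\<in>I. p i * (log_gap q + (1 - 1 / q) * (r i - q))) =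
        (\<Sum>i\<in>I. p i * (log_gap q - (1 - 1 / q) * q) + (1 - 1 / q) * (p i * r i))"
      by (intro sum.cong refl) (simp add: algebra_simps)
    also have "\<dots> = sum p I * (log_gap q - (1 - 1 / q) * q) + (1 - 1 / q) * (\<Sum>i\<in>I. p i * r i)"
      by (simp only: sum.distrib sum_distrib_left sum_distrib_right)
    also have "\<dots> = log_gap q" using p(2) avg(1) by simp
    finally show ?thesis by simp
  qed
  also have "\<dots> \<le> (\<Sum>i\<in>I. log_gap (r i))"
  proof (rule sum_mono)
    fix i assume i: "i \<in> I"
    have "ln (r i / q) \<le> r i / q - 1" using r[OF i] avg(2) by (intro ln_le_minus_one) simp
    then have "log_gap q + (1 - 1 / q) * (r i - q) \<le> log_gap (r i)"
      using r[OF i] avg(2) by (simp add: log_gap_def ln_div algebra_simps)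
    then have "p i * (log_gap q + (1 - 1 / q) * (r i - q)) \<le> p i * log_gap (r i)"
      using p(1)[OF i] by (rule mult_left_mono)
    also have "\<dots> \<le> 1 * log_gap (r i)" using p1[OF i] log_gap_nonneg[OF r[OF i]] by (rule mult_right_mono)
    finally show "p i * (log_gap q + (1 - 1 / q) * (r i - q)) \<le> log_gap (r i)" by simp
  qed
  finally show ?thesis .
qed

lemma square_average_le:
  fixes p z :: "'i \<Rightarrow> real"
  assumes I: "finite I" and p: "\<And>i. i \<in> I \<Longrightarrow> 0 \<le> p i" "sum p I = 1"
  shows "(\<Sum>i\<in>I. p i * z i)\<^sup>2 \<le> (\<Sum>i\<in>I. (z i)\<^sup>2)"
proof -
  define a where "a = (\<Sum>i\<in>I. p i * z i)"
  have p1: "p i \<le> 1" if "i \<in> I" for i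
    using member_le_sum[of i I p] that I p by auto
  have "0 \<le> (\<Sum>i\<in>I. p i * (z i - a)\<^sup>2)" using p by (intro sum_nonneg) auto
  also have "\<dots> = (\<Sum>i\<in>I. p i * (z i)\<^sup>2 + (a\<^sup>2 * p i - 2 * a * (p i * z i)))"
    by (intro sum.cong refl) (simp add: power2_eq_square algebra_simps)
  also have "\<dots> = (\<Sum>i\<in>I. p i * (z i)\<^sup>2) + (a\<^sup>2 * sum p I - 2 * a * a)"
    by (simp only: sum.distrib sum_subtractf sum_distrib_left[symmetric] a_def)
  also have "\<dots> = (\<Sum>i\<in>I. p i * (z i)\<^sup>2) - a\<^sup>2" using p(2) by (simp add: power2_eq_square)
  also have "(\<Sum>i\<in>I. p i * (z i)\<^sup>2) \<le> (\<Sum>i\<in>I. (z i)\<^sup>2)"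
    using p1 by (intro sum_mono mult_left_le_one_le) (auto simp: p)
  finally show ?thesis by (simp add: a_def)
qed

text \<open>
  The logarithm of Weierstrass' inequality \<open>\<Prod>\<^sub>i (1 + z\<^sub>i) \<ge> 1 + \<Sum>\<^sub>i z\<^sub>i\<close>.
\<close>

lemma ln_one_plus_sum_le:
  fixes z :: "'i \<Rightarrow> real"
  assumes "finite I" "\<And>i. i \<in> I \<Longrightarrow> 0 \<le> z i"
  shows "ln (1 + sum z I) \<le> (\<Sum>i\<in>I. ln (1 + z i))"
  using assms
proof (induction I rule: finite_induct)
  case (insert i I)
  have zi: "0 \<le> z i" "0 \<le> sum z I" using insert.prems by (auto intro: sum_nonneg)
  have "1 + sum z (insert i I) \<le> (1 + z i) * (1 + sum z I)"
    using insert zi by (simp add: algebra_simps)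
  then have "ln (1 + sum z (insert i I)) \<le> ln ((1 + z i) * (1 + sum z I))"
    using insert.prems insert.hyps(1) by (intro ln_mono add_pos_nonneg sum_nonneg) auto
  also have "\<dots> = ln (1 + z i) + ln (1 + sum z I)" using zi by (intro ln_mult_pos) auto
  finally show ?case using insert by simp
qed simp

text \<open>
  After division by the two sums this is the convexity of \<open>exp\<close>, term by term. The exponents \<open>\<gamma>\<close> are
  only required to lie below the interpolated ones, because the exponents that occur are themselves
  convex functions of the portfolio.
\<close>

lemma log_sum_exp_convex:
  fixes E \<alpha> \<beta> :: "'a \<Rightarrow> real"
  assumes F: "finite F" and E: "\<And>f. f \<in> F \<Longrightarrow> 0 \<le> E f"
    and A: "0 < (\<Sum>f\<in>F. E f * exp (\<alpha> f))" and B: "0 < (\<Sum>f\<in>F. E f * exp (\<beta> f))"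
    and s: "0 \<le> s" "s \<le> 1"
    and C: "0 < (\<Sum>f\<in>F. E f * exp (\<gamma> f))"
    and le: "\<And>f. f \<in> F \<Longrightarrow> \<gamma> f \<le> (1 - s) * \<alpha> f + s * \<beta> f"
  shows "ln (\<Sum>f\<in>F. E f * exp (\<gamma> f)) \<le>
    (1 - s) * ln (\<Sum>f\<in>F. E f * exp (\<alpha> f)) + s * ln (\<Sum>f\<in>F. E f * exp (\<beta> f))"
proof -
  define a where "a = ln (\<Sum>f\<in>F. E f * exp (\<alpha> f))"
  define b where "b = ln (\<Sum>f\<in>F. E f * exp (\<beta> f))"
  define m where "m = (1 - s) * a + s * b"
  have ea: "exp a = (\<Sum>f\<in>F. E f * exp (\<alpha> f))" and eb: "exp b = (\<Sum>f\<in>F. E f * exp (\<beta> f))"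
    using A B by (simp_all add: a_def b_def)
  have "(\<Sum>f\<in>F. E f * exp (\<gamma> f)) * exp (- m) \<le>
      (\<Sum>f\<in>F. (1 - s) * exp (- a) * (E f * exp (\<alpha> f)) + s * exp (- b) * (E f * exp (\<beta> f)))"
    unfolding sum_distrib_right
  proof (rule sum_mono)
    fix f assume f: "f \<in> F"
    have "exp (\<gamma> f) * exp (- m) \<le> exp ((1 - s) * (\<alpha> f - a) + s * (\<beta> f - b))"
      using le[OF f] by (simp add: m_def exp_add[symmetric] algebra_simps)
    also have "\<dots> \<le> (1 - s) * exp (\<alpha> f - a) + s * exp (\<beta> f - b)"
      using convex_onD[OF exp_convex, of s "\<alpha> f - a" "\<beta> f - b"] s by simp
    also have "\<dots> = (1 - s) * exp (- a) * exp (\<alpha> f) + s * exp (- b) * exp (\<beta> f)"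
      by (simp add: exp_diff exp_minus divide_inverse mult_ac)
    finally show "E f * exp (\<gamma> f) * exp (- m) \<le>
        (1 - s) * exp (- a) * (E f * exp (\<alpha> f)) + s * exp (- b) * (E f * exp (\<beta> f))"
      using E[OF f] mult_left_mono[of "exp (\<gamma> f) * exp (- m)"
          "(1 - s) * exp (- a) * exp (\<alpha> f) + s * exp (- b) * exp (\<beta> f)" "E f"]
      by (simp add: algebra_simps)
  qed
  also have "\<dots> = (1 - s) * exp (- a) * exp a + s * exp (- b) * exp b"
    unfolding ea eb by (simp add: sum.distrib sum_distrib_left)
  also have "\<dots> = 1" by (simp add: mult.assoc exp_add[symmetric])
  finally have "(\<Sum>f\<in>F. E f * exp (\<gamma> f)) \<le> exp m" by (simp add: exp_minus field_simps)
  then have "ln (\<Sum>f\<in>F. E f * exp (\<gamma> f)) \<le> m" using C ln_mono[of "\<Sum>f\<in>F. E f * exp (\<gamma> f)" "exp m"] by simp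
  then show ?thesis by (simp add: m_def a_def b_def)
qed

text \<open>
  With \<open>z = 2 \<mu> / \<lambda>\<close> the hypothesis reads \<open>8 (1 + \<lambda>) (1 + z)\<^sup>2 \<le> 5 \<lambda> \<mu>\<close>. The estimate \<open>(1 + z)\<^sup>2 \<ge> 4 z\<close> removes
  \<open>\<mu>\<close> and leaves \<open>64 (1 + \<lambda>) \<le> 5 \<lambda>\<^sup>2\<close>, hence the first bound. The estimate \<open>\<mu> \<ge> 8/5 (1 + z)\<^sup>2\<close> first gives
  \<open>\<mu> \<ge> 8/5\<close>, and this, inserted into \<open>z\<close>, gives the second bound.
\<close>

lemma parameter_bounds:
  fixes lam mu :: real
  assumes "0 < lam" "0 < mu" "1 / lam * (1 + 2 * mu / lam)\<^sup>2 \<le> 5 * mu / (8 * (1 + lam))"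
  shows "27 / 2 \<le> lam" and "8 / 5 * (1 + 16 / (5 * lam))\<^sup>2 \<le> mu"
proof -
  define z where "z = 2 * mu / lam"
  have z: "0 < z" "mu = z * lam / 2" using assms by (auto simp: z_def)
  have main: "8 * (1 + lam) * (1 + z)\<^sup>2 \<le> 5 * mu * lam"
  proof -
    have "(1 + z)\<^sup>2 / lam \<le> 5 * mu / (8 * (1 + lam))" using assms(3) by (simp add: z_def)
    then show ?thesis using assms(1) by (simp add: divide_simps mult_ac split: if_splits)
  qed
  have "4 * z \<le> (1 + z)\<^sup>2" using zero_le_power2[of "1 - z"] by (simp add: power2_eq_square algebra_simps)
  then have "8 * (1 + lam) * (4 * z) \<le> 8 * (1 + lam) * (1 + z)\<^sup>2"
    using assms by (intro mult_left_mono) auto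
  then have "z * (64 * (1 + lam)) \<le> z * (5 * lam\<^sup>2)" using main z by (simp add: power2_eq_square algebra_simps)
  then have quad: "64 * (1 + lam) \<le> 5 * lam\<^sup>2" using z by simp
  show lam: "27 / 2 \<le> lam"
  proof (rule ccontr)
    assume small: "\<not> 27 / 2 \<le> lam"
    then have "lam * lam \<le> lam * (27 / 2)" using assms by (intro mult_left_mono) auto
    then have "64 * (1 + lam) \<le> 135 / 2 * lam" using quad by (simp add: power2_eq_square)
    then show False using small by simp
  qed
  have "lam * (8 * (1 + z)\<^sup>2) \<le> (1 + lam) * (8 * (1 + z)\<^sup>2)" by (intro mult_right_mono) auto
  also have "\<dots> \<le> lam * (5 * mu)" using main by (simp only: mult_ac)
  finally have mz: "8 / 5 * (1 + z)\<^sup>2 \<le> mu" using assms(1) by simp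
  have "1 \<le> (1 + z)\<^sup>2" using z by (simp add: one_le_power)
  then have "8 / 5 \<le> mu" using mz by simp
  then have "16 / (5 * lam) \<le> z" using assms(1) by (simp add: z_def field_simps)
  then have "(1 + 16 / (5 * lam))\<^sup>2 \<le> (1 + z)\<^sup>2" using assms(1) by (intro power_mono) auto
  then show "8 / 5 * (1 + 16 / (5 * lam))\<^sup>2 \<le> mu" using mz by simp
qed

text \<open>
  From \<open>\<lambda> (r - 1 - ln r) < ln r\<close> and \<open>ln r \<le> (r - 1/r) / 2\<close> one gets \<open>r \<le> (1 + \<epsilon>) / (1 - \<epsilon>)\<close>. So \<open>r\<close> is close
  to \<open>1\<close>, and the logarithm is close to \<open>1 - 1/r\<close>.
\<close>

lemma small_divergence_ratio:
  fixes lam r B :: real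
  assumes lam: "27 / 2 \<le> lam" and r: "0 < r" and B: "lam * log_gap r \<le> B" "B < ln r"
  defines "\<epsilon> \<equiv> 1 / lam"
  shows "1 < r" and "(1 - \<epsilon>) * ln r \<le> 1 - 1 / r" and "B \<le> 2 * \<epsilon> / (1 - \<epsilon>\<^sup>2)"
proof -
  have eps: "0 < \<epsilon>" "\<epsilon> \<le> 2 / 27" using lam by (auto simp: \<epsilon>_def field_simps)
  have "0 \<le> lam * log_gap r" using log_gap_nonneg[OF r] lam by simp
  then have "0 \<le> B" using B(1) by simp
  then have "0 < ln r" using B by simp
  then show r1: "1 < r" using r by simp
  have "\<epsilon> * (lam * log_gap r) \<le> \<epsilon> * ln r" using B eps by (intro mult_left_mono) auto
  then have "log_gap r \<le> \<epsilon> * ln r" using lam by (simp add: \<epsilon>_def)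
  then have 1: "r - 1 \<le> (1 + \<epsilon>) * ln r" by (simp add: log_gap_def algebra_simps)
  have half: "ln r \<le> (r - 1 / r) / 2" using ln_le_half_diff r1 by simp
  also have "\<dots> = (r - 1) * (r + 1) / (2 * r)" using r1 by (simp add: field_simps)
  finally have "r - 1 \<le> (1 + \<epsilon>) * ((r - 1) * (r + 1) / (2 * r))"
    using 1 eps mult_left_mono[of "ln r" "(r - 1) * (r + 1) / (2 * r)" "1 + \<epsilon>"] by simp
  then have "(r - 1) * (2 * r) \<le> (r - 1) * ((1 + \<epsilon>) * (r + 1))" using r1 by (simp add: field_simps)
  then have "2 * r \<le> (1 + \<epsilon>) * (r + 1)" using r1 by simp
  then have 2: "(1 - \<epsilon>) * r \<le> 1 + \<epsilon>" by (simp add: algebra_simps)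
  have a: "1 - 1 / r = (r - 1) / r" using r by (simp add: field_simps)
  have "(1 - \<epsilon>) * (r + 1) \<le> 2" using 2 by (simp add: algebra_simps)
  then have "(r - 1) * ((1 - \<epsilon>) * (r + 1)) \<le> (r - 1) * 2" using r1 by (intro mult_left_mono) auto
  then have "(r - 1) * ((1 - \<epsilon>) * (r + 1)) / (2 * r) \<le> (r - 1) * 2 / (2 * r)"
    using r1 by (intro divide_right_mono) auto
  also have "\<dots> = (r - 1) / r" by (metis mult.commute mult_divide_mult_cancel_left zero_neq_numeral)
  finally have "(1 - \<epsilon>) * ((r - 1) * (r + 1) / (2 * r)) \<le> (r - 1) / r" by (simp add: mult_ac)
  moreover have "(1 - \<epsilon>) * ln r \<le> (1 - \<epsilon>) * ((r - 1) * (r + 1) / (2 * r))"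
    using half r1 eps by (intro mult_left_mono) (auto simp: field_simps)
  ultimately show 3: "(1 - \<epsilon>) * ln r \<le> 1 - 1 / r" using a by simp
  have "(r - 1) * (1 + \<epsilon>) \<le> 2 * \<epsilon> * r" using 2 by (simp add: algebra_simps)
  then have "(1 - 1 / r) * (1 + \<epsilon>) \<le> 2 * \<epsilon>" using r1 by (simp add: field_simps)
  moreover have "(1 - \<epsilon>) * B * (1 + \<epsilon>) \<le> (1 - 1 / r) * (1 + \<epsilon>)"
  proof (rule mult_right_mono)
    have "(1 - \<epsilon>) * B \<le> (1 - \<epsilon>) * ln r" using B eps by (intro mult_left_mono) auto
    then show "(1 - \<epsilon>) * B \<le> 1 - 1 / r" using 3 by simp
  qed (use eps in simp)
  ultimately have "B * (1 - \<epsilon>\<^sup>2) \<le> 2 * \<epsilon>" by (simp add: power2_eq_square algebra_simps)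
  moreover have "\<epsilon>\<^sup>2 < 1" using eps by (simp add: abs_square_less_1)
  ultimately show "B \<le> 2 * \<epsilon> / (1 - \<epsilon>\<^sup>2)" by (simp add: field_simps)
qed

text \<open>
  Below \<open>1\<close> the divergence is at least half the squared distance to \<open>1\<close>, so a divergence of at most
  \<open>B / \<lambda> \<le> 2 \<epsilon>\<^sup>2 / (1 - \<epsilon>\<^sup>2)\<close> only allows a distance of \<open>2 \<epsilon> / \<surd>(1 - \<epsilon>\<^sup>2)\<close> below \<open>1\<close>, where \<open>\<epsilon> = 1/\<lambda>\<close>. The number
  \<open>2.01 \<epsilon>\<close> is a convenient upper bound of this for \<open>\<epsilon> \<le> 2/27\<close>.
\<close>

lemma small_divergence_lower:
  fixes lam r B :: real
  assumes lam: "27 / 2 \<le> lam" and r: "0 < r" and B: "lam * log_gap r \<le> B" "B \<le> 2 * (1 / lam) / (1 - (1 / lam)\<^sup>2)"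
  shows "1 - 201 / (100 * lam) \<le> r"
proof (cases "r \<le> 1")
  case True
  define \<epsilon> where "\<epsilon> = 1 / lam"
  have eps: "0 < \<epsilon>" "\<epsilon> \<le> 2 / 27" using lam by (auto simp: \<epsilon>_def field_simps)
  have B2: "lam * log_gap r \<le> 2 * \<epsilon> / (1 - \<epsilon>\<^sup>2)" using B unfolding \<epsilon>_def by linarith
  have "\<epsilon>\<^sup>2 \<le> (2 / 27)\<^sup>2" using eps by (intro power_mono) auto
  then have e2: "\<epsilon>\<^sup>2 \<le> 4 / 729" by (simp add: power_divide)
  have "4 \<le> 40401 / 10000 * (1 - \<epsilon>\<^sup>2)" using e2 by (simp add: algebra_simps)
  moreover have "0 < 1 - \<epsilon>\<^sup>2" using e2 by linarith
  ultimately have ratio: "4 / (1 - \<epsilon>\<^sup>2) \<le> (201 / 100)\<^sup>2" by (simp add: pos_divide_le_eq power_divide)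
  have "(1 - r)\<^sup>2 \<le> 2 * log_gap r" by (rule log_gap_quadratic_lower[OF r True])
  also have "2 * log_gap r = 2 * \<epsilon> * (lam * log_gap r)" using lam by (simp add: \<epsilon>_def)
  also have "\<dots> \<le> 2 * \<epsilon> * (2 * \<epsilon> / (1 - \<epsilon>\<^sup>2))" using B2 eps by (intro mult_left_mono) simp_all
  also have "\<dots> = \<epsilon>\<^sup>2 * (4 / (1 - \<epsilon>\<^sup>2))" by (simp add: power2_eq_square)
  also have "\<dots> \<le> \<epsilon>\<^sup>2 * (201 / 100)\<^sup>2"
    using ratio by (intro mult_left_mono) auto
  finally have "(1 - r)\<^sup>2 \<le> (\<epsilon> * (201 / 100))\<^sup>2" by (simp only: power_mult_distrib)
  then have "1 - r \<le> \<epsilon> * (201 / 100)" by (rule power2_le_imp_le) (use eps in simp)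
  moreover have "\<epsilon> * (201 / 100) = 201 / (100 * lam)" by (simp add: \<epsilon>_def)
  ultimately show ?thesis by linarith
next
  case False
  have "0 \<le> 201 / (100 * lam)" using lam by simp
  then show ?thesis using False by linarith
qed

text \<open>
  The scalar inequality behind the stability of the algorithm. With \<open>a = 1 - 1/r\<close> and \<open>N \<le> 2 B / \<rho>\<^sup>2\<close>, the
  estimate \<open>ln (1 + y) \<ge> (1 - \<epsilon>) y\<close> for \<open>0 \<le> y \<le> \<epsilon>\<close> bounds the right-hand side from below by
  \<open>B + \<mu> (1 - \<epsilon>) \<rho>\<^sup>2 a\<^sup>2 / (4 B)\<close>. By the inequality of arithmetic and geometric means this is at least
  \<open>a \<rho> \<surd>(\<mu> (1 - \<epsilon>))\<close>, and the lower bound on \<open>\<mu>\<close> makes this at least \<open>a / (1 - \<epsilon>) \<ge> ln r\<close>.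
\<close>

lemma divergence_log_tradeoff:
  fixes lam mu r B N :: real
  assumes lam: "27 / 2 \<le> lam" and mu: "8 / 5 * (1 + 16 / (5 * lam))\<^sup>2 \<le> mu"
    and r: "0 < r" and B: "lam * log_gap r \<le> B" "B < ln r"
    and N: "lam * (1 - 1 / r)\<^sup>2 \<le> N" "(1 - 201 / (100 * lam))\<^sup>2 * N \<le> 2 * B"
  shows "ln r \<le> B + mu / 2 * ln (1 + (1 - 1 / r)\<^sup>2 / N)"
proof -
  define \<epsilon> where "\<epsilon> = 1 / lam"
  define a where "a = 1 - 1 / r"
  define \<rho> where "\<rho> = 1 - 201 / 100 * \<epsilon>"
  define y where "y = a\<^sup>2 / N"
  have eps: "0 < \<epsilon>" "\<epsilon> \<le> 2 / 27" using lam by (auto simp: \<epsilon>_def field_simps)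
  have r1: "1 < r" and lnr: "(1 - \<epsilon>) * ln r \<le> a"
    using small_divergence_ratio[OF lam r B] by (auto simp: \<epsilon>_def a_def)
  have a: "0 < a" using r1 by (simp add: a_def)
  have "0 < lam * a\<^sup>2" using a lam by simp
  then have N0: "0 < N" using N(1) unfolding a_def[symmetric] by linarith
  have rho: "0 < \<rho>" "\<rho> \<le> 1" using eps by (auto simp: \<rho>_def)
  have "\<rho> = 1 - 201 / (100 * lam)" by (simp add: \<rho>_def \<epsilon>_def)
  then have NB: "\<rho>\<^sup>2 * N \<le> 2 * B" using N(2) by simp
  moreover have "0 < \<rho>\<^sup>2 * N" using rho N0 by simp
  ultimately have B0: "0 < B" by linarith
  have "lam * a\<^sup>2 \<le> N" using N(1) by (simp add: a_def)
  then have "\<epsilon> * (lam * a\<^sup>2) \<le> \<epsilon> * N" using eps by (intro mult_left_mono) auto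
  then have y: "0 \<le> y" "y \<le> \<epsilon>" using N0 lam by (simp_all add: y_def \<epsilon>_def pos_divide_le_eq)
  have yB: "\<rho>\<^sup>2 * a\<^sup>2 / (2 * B) \<le> y"
  proof -
    have "a\<^sup>2 * (\<rho>\<^sup>2 * N) \<le> a\<^sup>2 * (2 * B)" using NB by (intro mult_left_mono) auto
    then show ?thesis using N0 B0 by (simp add: y_def field_simps)
  qed
  have mu0: "0 < mu"
  proof -
    have "0 < 1 + 16 / (5 * lam)" using lam by (simp add: add_pos_pos)
    then have "0 < 8 / 5 * (1 + 16 / (5 * lam))\<^sup>2" by simp
    then show ?thesis using mu by linarith
  qed
  have Q: "1 \<le> mu * (1 - \<epsilon>) * \<rho>\<^sup>2 * (1 - \<epsilon>)\<^sup>2"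
  proof -
    \<comment> \<open>The bound on \<open>\<mu>\<close> enters as a square, and its root pays for \<open>\<rho>\<close> and \<open>1 - \<epsilon>\<close> up to a loss of 4 percent.\<close>
    have "(24 / 25) \<le> (1 + 16 / 5 * \<epsilon>) * \<rho> * (1 - \<epsilon>)"
    proof -
      have *: "0 \<le> \<epsilon> * (2 / 27 - \<epsilon>)" using eps by simp
      have expand: "(1 + c * x) * (1 - k * x) * (1 - x) =
          1 + (c - k - 1) * x - (c * (k + 1) - k) * x\<^sup>2 + c * k * x ^ 3" for c k x :: real
        by (simp add: power2_eq_square power3_eq_cube algebra_simps)
      have "(1 + 16 / 5 * \<epsilon>) * \<rho> * (1 - \<epsilon>) =
          1 + 19 / 100 * \<epsilon> - 3811 / 500 * \<epsilon>\<^sup>2 + 804 / 125 * \<epsilon> ^ 3"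
        unfolding \<rho>_def expand by simp
      moreover have "0 \<le> \<epsilon> ^ 3" using eps by simp
      moreover have "\<epsilon>\<^sup>2 \<le> 2 / 27 * \<epsilon>" using * by (simp add: power2_eq_square algebra_simps)
      ultimately show ?thesis using eps by linarith
    qed
    then have "(24 / 25)\<^sup>2 \<le> ((1 + 16 / 5 * \<epsilon>) * \<rho> * (1 - \<epsilon>))\<^sup>2" by (intro power_mono) auto
    then have sq: "(24 / 25)\<^sup>2 \<le> (1 + 16 / 5 * \<epsilon>)\<^sup>2 * \<rho>\<^sup>2 * (1 - \<epsilon>)\<^sup>2" by (simp only: power_mult_distrib)
    have "1 \<le> 8 / 5 * (1 - \<epsilon>) * (576 / 625)" using eps by simp
    also have "576 / 625 = (24 / 25 :: real)\<^sup>2" by (simp add: power_divide)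
    finally have "1 \<le> 8 / 5 * (1 - \<epsilon>) * (24 / 25)\<^sup>2" .
    also have "8 / 5 * (1 - \<epsilon>) * (24 / 25)\<^sup>2 \<le> 8 / 5 * (1 - \<epsilon>) * ((1 + 16 / 5 * \<epsilon>)\<^sup>2 * \<rho>\<^sup>2 * (1 - \<epsilon>)\<^sup>2)"
      using sq eps by (intro mult_left_mono) auto
    also have "\<dots> = (8 / 5 * (1 + 16 / 5 * \<epsilon>)\<^sup>2) * ((1 - \<epsilon>) * \<rho>\<^sup>2 * (1 - \<epsilon>)\<^sup>2)" by (simp only: mult_ac)
    also have "\<dots> \<le> mu * ((1 - \<epsilon>) * \<rho>\<^sup>2 * (1 - \<epsilon>)\<^sup>2)"
    proof (rule mult_right_mono)
      have "16 / 5 * \<epsilon> = 16 / (5 * lam)" by (simp add: \<epsilon>_def)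
      then show "8 / 5 * (1 + 16 / 5 * \<epsilon>)\<^sup>2 \<le> mu" using mu by (simp only:)
    qed (use eps in simp)
    finally show ?thesis by (simp only: mult_ac)
  qed
  have "mu * (1 - \<epsilon>) * (\<rho>\<^sup>2 * a\<^sup>2 / (2 * B)) / 2 \<le> mu * (1 - \<epsilon>) * y / 2"
    using yB mu0 eps by (intro divide_right_mono mult_left_mono) auto
  also have "\<dots> = mu / 2 * (y * (1 - \<epsilon>))" by simp
  also have "\<dots> \<le> mu / 2 * (y - y\<^sup>2)"
  proof -
    have "y * y \<le> y * \<epsilon>" using y by (intro mult_left_mono) auto
    then show ?thesis using mu0 by (intro mult_left_mono) (auto simp: power2_eq_square algebra_simps)
  qed
  also have "\<dots> \<le> mu / 2 * ln (1 + y)"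
    using ln_one_plus_pos_lower_bound[of y] y eps mu0
    by (intro mult_left_mono) (auto simp: power2_eq_square)
  finally have low: "mu * (1 - \<epsilon>) * (\<rho>\<^sup>2 * a\<^sup>2 / (2 * B)) / 2 \<le> mu / 2 * ln (1 + y)" .
  \<comment> \<open>The number \<open>c\<close> lies above \<open>ln r\<close>, and \<open>c \<le> B + c\<^sup>2 / (4 B)\<close> for every \<open>B > 0\<close>.\<close>
  define c where "c = a / (1 - \<epsilon>)"
  have c: "ln r \<le> c" using lnr eps by (simp add: c_def field_simps)
  have "c\<^sup>2 * 1 \<le> c\<^sup>2 * (mu * (1 - \<epsilon>) * \<rho>\<^sup>2 * (1 - \<epsilon>)\<^sup>2)" using Q by (intro mult_left_mono) auto
  also have "\<dots> = (1 - \<epsilon>)\<^sup>2 * c\<^sup>2 * (mu * (1 - \<epsilon>) * \<rho>\<^sup>2)" by (simp add: mult_ac)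
  also have "(1 - \<epsilon>)\<^sup>2 * c\<^sup>2 = a\<^sup>2" using eps by (simp add: c_def power_mult_distrib[symmetric])
  finally have "c\<^sup>2 / (4 * B) \<le> a\<^sup>2 * (mu * (1 - \<epsilon>) * \<rho>\<^sup>2) / (4 * B)"
    using B0 by (intro divide_right_mono) auto
  also have "\<dots> = mu * (1 - \<epsilon>) * (\<rho>\<^sup>2 * a\<^sup>2 / (2 * B)) / 2" by (simp add: mult_ac)
  also note low
  finally have "c\<^sup>2 / (4 * B) \<le> mu / 2 * ln (1 + y)" .
  moreover have "c \<le> B + c\<^sup>2 / (4 * B)"
    using zero_le_power2[of "2 * B - c"] B0 by (simp add: power2_eq_square field_simps)
  ultimately show ?thesis using c by (simp add: y_def a_def)
qed

section \<open>The volumetric barrier as a Gram determinant\<close>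

locale portfolio =
  fixes d T :: nat and lam :: real and x :: "nat \<Rightarrow> real Matrix.vec"
  assumes d_pos: "1 \<le> d" and lam_pos: "0 < lam"
    and returns: "\<And>t. t \<in> {1..T} \<Longrightarrow> x t \<in> nonneg_orthant d - {0\<^sub>v d}"
begin

text \<open>
  The logarithmic terms of the regularized loss are indexed by a sum type, so that barrier and losses
  are treated alike: \<open>Inl m\<close> is the barrier term of coordinate \<open>m\<close>, and \<open>Inr \<tau>\<close> is the loss of round \<open>\<tau>\<close>.
\<close>

definition idx :: "nat \<Rightarrow> (nat + nat) set" where
  "idx t = {..<d} <+> {1..t}"

fun coef :: "nat + nat \<Rightarrow> nat \<Rightarrow> real" where
  "coef (Inl m) i = (if i = m then 1 else 0)"
| "coef (Inr \<tau>) i = vec_index (x \<tau>) i"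

fun wt :: "nat + nat \<Rightarrow> real" where
  "wt (Inl m) = lam"
| "wt (Inr \<tau>) = 1"

definition ret :: "nat + nat \<Rightarrow> real Matrix.vec \<Rightarrow> real" where
  "ret k w = (\<Sum>i<d. coef k i * vec_index w i)"

text \<open>
  The values of the form \<open>coef k\<close> on the columns \<open>e\<^sub>i - e\<^sub>d\<close> of the matrix \<open>A\<close>, which span the
  directions in which one can move inside the simplex.
\<close>

definition tangent_coef :: "nat + nat \<Rightarrow> nat \<Rightarrow> real" where
  "tangent_coef k i = coef k i - coef k (d - 1)"

definition vol_det :: "nat \<Rightarrow> real Matrix.vec \<Rightarrow> real" where
  "vol_det t w = gram_det (d - 1) (idx t) tangent_coef (\<lambda>k. wt k / (ret k w)\<^sup>2)"

lemma finite_idx [simp]: "finite (idx t)"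
  by (simp add: idx_def)

lemma wt_pos [simp]: "0 < wt k"
  by (cases k) (auto simp: lam_pos)

lemma sum_idx: "(\<Sum>k\<in>idx t. g k) = (\<Sum>m<d. g (Inl m)) + (\<Sum>\<tau>\<in>{1..t}. g (Inr \<tau>))"
  by (simp add: idx_def sum.Plus)

lemma ret_Inl [simp]:
  assumes "m < d"
  shows "ret (Inl m) w = vec_index w m"
proof -
  have "ret (Inl m) w = (\<Sum>i<d. if i = m then vec_index w i else 0)"
    unfolding ret_def by (intro sum.cong) auto
  then show ?thesis using assms by simp
qed

lemma ret_Inr: "w \<in> carrier_vec d \<Longrightarrow> ret (Inr \<tau>) w = scalar_prod (x \<tau>) w"
  by (auto simp: ret_def scalar_prod_def lessThan_atLeast0)

lemma coef_nonneg: "k \<in> idx T \<Longrightarrow> i < d \<Longrightarrow> 0 \<le> coef k i"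
  using returns by (auto simp: idx_def nonneg_orthant_def)

lemma coef_nonzero:
  assumes "k \<in> idx T"
  shows "\<exists>i<d. 0 < coef k i"
proof (cases k)
  case (Inl m)
  then show ?thesis using assms by (auto simp: idx_def)
next
  case (Inr \<tau>)
  then have \<tau>: "\<tau> \<in> {1..T}" using assms by (auto simp: idx_def)
  show ?thesis
  proof (rule ccontr)
    assume "\<not> ?thesis"
    then have "vec_index (x \<tau>) i = 0" if "i < d" for i
      using coef_nonneg[OF assms that] Inr that \<open>\<not> (\<exists>i<d. 0 < coef k i)\<close>
      by (metis coef.simps(2) less_eq_real_def)
    then have "x \<tau> = 0\<^sub>v d" using returns[OF \<tau>] by (intro eq_vecI) (auto simp: nonneg_orthant_def)
    then show False using returns[OF \<tau>] by simp
  qed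
qed

lemma ret_pos:
  assumes "k \<in> idx T" "w \<in> pos_orthant d"
  shows "0 < ret k w"
proof -
  obtain i where i: "i < d" "0 < coef k i" using coef_nonzero[OF assms(1)] by auto
  show ?thesis unfolding ret_def
  proof (rule sum_pos2[of _ i])
    show "0 < coef k i * vec_index w i" using i assms(2) by (auto simp: pos_orthant_def)
    fix j assume "j \<in> {..<d}"
    then show "0 \<le> coef k j * vec_index w j" using coef_nonneg[OF assms(1)] assms(2)
      by (auto simp: pos_orthant_def less_imp_le)
  qed (use i in auto)
qed

lemma idx_mono: "s \<le> t \<Longrightarrow> idx s \<subseteq> idx t"
  by (auto simp: idx_def)

lemma reg_loss_eq:
  "w \<in> carrier_vec d \<Longrightarrow> reg_loss d lam x t w = (\<Sum>k\<in>idx t. wt k * (- ln (ret k w)))"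
  by (simp add: reg_loss_def log_barrier_def sum_idx ret_Inr sum_distrib_left sum_negf)

lemma ret_add_unit:
  assumes "w \<in> carrier_vec d" "j < d"
  shows "ret k (w + s \<cdot>\<^sub>v unit_vec (dim_vec w) j) = ret k w + s * coef k j"
proof -
  have "ret k (w + s \<cdot>\<^sub>v unit_vec (dim_vec w) j) =
      (\<Sum>i<d. coef k i * vec_index w i + (if i = j then s * coef k j else 0))"
    unfolding ret_def using assms by (intro sum.cong refl) (auto simp: algebra_simps)
  also have "\<dots> = ret k w + s * coef k j"
    using assms by (simp add: sum.distrib ret_def)
  finally show ?thesis .
qed

lemma partial_deriv_reg_loss:
  assumes w: "w \<in> pos_orthant d" and t: "t \<le> T" and j: "j < d"
  shows "partial_deriv j (reg_loss d lam x t) w = (\<Sum>k\<in>idx t. wt k * (- (coef k j / ret k w)))"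
proof -
  have wc: "w \<in> carrier_vec d" using w by (simp add: pos_orthant_def)
  have "((\<lambda>s. \<Sum>k\<in>idx t. wt k * (- ln (ret k w + s * coef k j))) has_real_derivative
      (\<Sum>k\<in>idx t. wt k * (- (coef k j / ret k w)))) (at 0)"
  proof (rule DERIV_sum)
    fix k assume "k \<in> idx t"
    then have "0 < ret k w" using ret_pos w idx_mono[OF t] by blast
    then show "((\<lambda>s. wt k * (- ln (ret k w + s * coef k j))) has_real_derivative
        wt k * (- (coef k j / ret k w))) (at 0)"
      by (auto intro!: derivative_eq_intros)
  qed
  moreover have "reg_loss d lam x t (w + s \<cdot>\<^sub>v unit_vec (dim_vec w) j) =
      (\<Sum>k\<in>idx t. wt k * (- ln (ret k w + s * coef k j)))" for s
  proof -
    have "w + s \<cdot>\<^sub>v unit_vec (dim_vec w) j \<in> carrier_vec d" using wc by simp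
    from reg_loss_eq[OF this] show ?thesis by (simp only: ret_add_unit[OF wc j])
  qed
  ultimately show ?thesis unfolding partial_deriv_def by (simp add: DERIV_imp_deriv)
qed

lemma hessian_reg_loss:
  assumes w: "w \<in> pos_orthant d" and t: "t \<le> T" and ij: "i < d" "j < d"
  shows "hessian (reg_loss d lam x t) w $$ (i, j) =
    (\<Sum>k\<in>idx t. wt k / (ret k w)\<^sup>2 * (coef k i * coef k j))"
proof -
  have wc: "w \<in> carrier_vec d" "dim_vec w = d" using w by (auto simp: pos_orthant_def)
  have wi: "0 < vec_index w i" using w ij by (simp add: pos_orthant_def)
  have "((\<lambda>s. \<Sum>k\<in>idx t. wt k * (- (coef k j / (ret k w + s * coef k i)))) has_real_derivative
      (\<Sum>k\<in>idx t. wt k / (ret k w)\<^sup>2 * (coef k i * coef k j))) (at 0)"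
  proof (rule DERIV_sum)
    fix k assume "k \<in> idx t"
    then have "0 < ret k w" using ret_pos w idx_mono[OF t] by blast
    then show "((\<lambda>s. wt k * (- (coef k j / (ret k w + s * coef k i)))) has_real_derivative
        wt k / (ret k w)\<^sup>2 * (coef k i * coef k j)) (at 0)"
      by (auto intro!: derivative_eq_intros simp: power2_eq_square)
  qed
  moreover have "eventually (\<lambda>s. partial_deriv j (reg_loss d lam x t) (w + s \<cdot>\<^sub>v unit_vec (dim_vec w) i) =
      (\<Sum>k\<in>idx t. wt k * (- (coef k j / (ret k w + s * coef k i))))) (nhds 0)"
  proof -
    have "eventually (\<lambda>s. s \<in> {- vec_index w i<..<vec_index w i}) (nhds 0)"
      using wi by (intro eventually_nhds_in_open) auto
    then show ?thesis
    proof eventually_elim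
      case (elim s)
      have "w + s \<cdot>\<^sub>v unit_vec (dim_vec w) i \<in> pos_orthant d"
        using elim w ij wc by (auto simp: pos_orthant_def)
      from partial_deriv_reg_loss[OF this t ij(2)] show ?case
        using ret_add_unit[OF wc(1) ij(1)] by simp
    qed
  qed
  ultimately have "partial_deriv i (partial_deriv j (reg_loss d lam x t)) w =
      (\<Sum>k\<in>idx t. wt k / (ret k w)\<^sup>2 * (coef k i * coef k j))"
    unfolding partial_deriv_def[of i] by (subst deriv_cong_ev[OF _ refl]) (auto intro: DERIV_imp_deriv)
  then show ?thesis using ij wc by (simp add: hessian_def)
qed

lemma sum_simplex_basis:
  assumes "i < d - 1"
  shows "(\<Sum>m<d. simplex_basis d $$ (m, i) * g m) = g i - (g (d - 1) :: real)"
proof -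
  have "(\<Sum>m<d. simplex_basis d $$ (m, i) * g m) =
      (\<Sum>m<d. (if m = i then g i else 0) + (if m = d - 1 then - g (d - 1) else 0))"
    using assms by (intro sum.cong refl) (auto simp: simplex_basis_def)
  also have "\<dots> = g i - g (d - 1)"
    using assms by (simp add: sum.distrib)
  finally show ?thesis .
qed

lemma vol_barrier_eq:
  assumes w: "w \<in> pos_orthant d" and t: "t \<le> T"
  shows "vol_barrier d lam x t w = 1 / 2 * ln (vol_det t w)"
proof -
  define A where "A = simplex_basis d"
  define Hs where "Hs = hessian (reg_loss d lam x t) w"
  have A: "A \<in> carrier_mat d (d - 1)" by (simp add: A_def simplex_basis_def)
  have Hs: "Hs \<in> carrier_mat d d" using w by (auto simp: Hs_def hessian_def pos_orthant_def)
  have "transpose_mat A * Hs * A =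
      Matrix.mat (d - 1) (d - 1) (\<lambda>(i, j). \<Sum>k\<in>idx t. wt k / (ret k w)\<^sup>2 * (tangent_coef k i * tangent_coef k j))"
  proof (rule eq_matI)
    fix i j assume "i < dim_row (Matrix.mat (d - 1) (d - 1) (\<lambda>(i, j). \<Sum>k\<in>idx t. wt k / (ret k w)\<^sup>2 * (tangent_coef k i * tangent_coef k j)))"
      "j < dim_col (Matrix.mat (d - 1) (d - 1) (\<lambda>(i, j). \<Sum>k\<in>idx t. wt k / (ret k w)\<^sup>2 * (tangent_coef k i * tangent_coef k j)))"
    then have ij: "i < d - 1" "j < d - 1" by auto
    have "(transpose_mat A * Hs * A) $$ (i, j) = (\<Sum>l<d. (\<Sum>m<d. A $$ (m, i) * Hs $$ (m, l)) * A $$ (l, j))"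
      using A Hs ij by (simp add: scalar_prod_def lessThan_atLeast0 del: assoc_mult_mat)
    also have "\<dots> = (\<Sum>l<d. A $$ (l, j) * (\<Sum>k\<in>idx t. wt k / (ret k w)\<^sup>2 * (tangent_coef k i * coef k l)))"
    proof (intro sum.cong refl)
      fix l assume "l \<in> {..<d}"
      then have l: "l < d" by simp
      have "(\<Sum>m<d. A $$ (m, i) * Hs $$ (m, l)) = Hs $$ (i, l) - Hs $$ (d - 1, l)"
        unfolding A_def by (rule sum_simplex_basis[OF ij(1)])
      also have "\<dots> = (\<Sum>k\<in>idx t. wt k / (ret k w)\<^sup>2 * (tangent_coef k i * coef k l))"
        using ij d_pos l unfolding Hs_def
        by (simp add: hessian_reg_loss[OF w t] sum_subtractf[symmetric] tangent_coef_def algebra_simps)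
      finally show "(\<Sum>m<d. A $$ (m, i) * Hs $$ (m, l)) * A $$ (l, j) =
          A $$ (l, j) * (\<Sum>k\<in>idx t. wt k / (ret k w)\<^sup>2 * (tangent_coef k i * coef k l))" by simp
    qed
    also have "\<dots> = (\<Sum>k\<in>idx t. wt k / (ret k w)\<^sup>2 * (tangent_coef k i * tangent_coef k j))"
      unfolding A_def sum_simplex_basis[OF ij(2)] tangent_coef_def[of _ j]
      by (simp add: sum_subtractf[symmetric] algebra_simps)
    finally show "(transpose_mat A * Hs * A) $$ (i, j) =
        Matrix.mat (d - 1) (d - 1) (\<lambda>(i, j). \<Sum>k\<in>idx t. wt k / (ret k w)\<^sup>2 * (tangent_coef k i * tangent_coef k j)) $$ (i, j)"
      using ij by simp
  qed (use A in auto)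
  then show ?thesis by (simp add: vol_barrier_def vol_det_def gram_det_def A_def Hs_def)
qed

text \<open>
  Drop every term except the barrier terms of the first \<open>d - 1\<close> coordinates; the matrix that remains is
  diagonal.
\<close>

lemma vol_det_lower:
  assumes w: "w \<in> pos_orthant d" and t: "t \<le> T"
  shows "(\<Prod>m<d-1. lam / (vec_index w m)\<^sup>2) \<le> vol_det t w"
proof -
  define n where "n = d - 1"
  define M where "M = Matrix.mat n n (\<lambda>(i, j). \<Sum>k\<in>Inl ` {..<n}. wt k / (ret k w)\<^sup>2 * (tangent_coef k i * tangent_coef k j))"
  have M: "M $$ (i, j) = (if i = j then lam / (vec_index w i)\<^sup>2 else 0)" if "i < n" "j < n" for i j
  proof -
    have "M $$ (i, j) = (\<Sum>m<n. if m = i then (if i = j then lam / (vec_index w i)\<^sup>2 else 0) else 0)"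
    proof -
      have "M $$ (i, j) = (\<Sum>m<n. wt (Inl m) / (ret (Inl m) w)\<^sup>2 * (tangent_coef (Inl m) i * tangent_coef (Inl m) j))"
        using that by (simp add: M_def sum.reindex)
      also have "\<dots> = (\<Sum>m<n. if m = i then (if i = j then lam / (vec_index w i)\<^sup>2 else 0) else 0)"
        using that by (intro sum.cong refl) (auto simp: tangent_coef_def n_def)
      finally show ?thesis .
    qed
    also have "\<dots> = (if i = j then lam / (vec_index w i)\<^sup>2 else 0)"
      using that by (subst sum.delta) auto
    finally show ?thesis .
  qed
  have Mc: "M \<in> carrier_mat n n" by (simp add: M_def)
  have "gram_det n (Inl ` {..<n}) tangent_coef (\<lambda>k. wt k / (ret k w)\<^sup>2) = Determinant.det M"
    by (simp add: gram_det_def M_def)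
  also have "\<dots> = prod_list (diag_mat M)"
    by (rule det_upper_triangular[OF _ Mc]) (use M Mc in auto)
  also have "\<dots> = (\<Prod>m<n. lam / (vec_index w m)\<^sup>2)"
    using M Mc by (simp add: prod_list_diag_prod lessThan_atLeast0)
  finally have "(\<Prod>m<n. lam / (vec_index w m)\<^sup>2) = gram_det n (Inl ` {..<n}) tangent_coef (\<lambda>k. wt k / (ret k w)\<^sup>2)"
    by simp
  also have "\<dots> \<le> vol_det t w"
    unfolding vol_det_def n_def by (rule gram_det_mono) (auto simp: idx_def less_imp_le)
  finally show ?thesis by (simp add: n_def)
qed

lemma vol_det_pos:
  assumes w: "w \<in> pos_orthant d" and t: "t \<le> T"
  shows "0 < vol_det t w"
proof -
  have "0 < (\<Prod>m<d-1. lam / (vec_index w m)\<^sup>2)"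
  proof (rule prod_pos)
    fix m assume "m \<in> {..<d-1}"
    then have "0 < vec_index w m" using w by (simp add: pos_orthant_def)
    then show "0 < lam / (vec_index w m)\<^sup>2" using lam_pos by simp
  qed
  then show ?thesis using vol_det_lower[OF assms] by linarith
qed

definition mix :: "real \<Rightarrow> real Matrix.vec \<Rightarrow> real Matrix.vec \<Rightarrow> real Matrix.vec" where
  "mix s v w = Matrix.vec d (\<lambda>i. (1 - s) * vec_index v i + s * vec_index w i)"

lemma mix_carrier [simp]: "mix s v w \<in> carrier_vec d"
  by (simp add: mix_def)

lemma ret_mix: "ret k (mix s v w) = (1 - s) * ret k v + s * ret k w"
  unfolding ret_def mix_def by (simp add: sum_distrib_left sum.distrib[symmetric] algebra_simps)

lemma mix_pos:
  assumes "v \<in> pos_orthant d" "w \<in> pos_orthant d" "0 \<le> s" "s \<le> 1"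
  shows "mix s v w \<in> pos_orthant d"
proof -
  have "0 < (1 - s) * vec_index v i + s * vec_index w i" if "i < d" for i
  proof (cases "s = 0")
    case False
    then show ?thesis using assms that by (intro add_nonneg_pos) (auto simp: pos_orthant_def less_imp_le)
  qed (use assms that in \<open>auto simp: pos_orthant_def\<close>)
  then show ?thesis by (simp add: pos_orthant_def mix_def)
qed

lemma mix_simplex:
  assumes "v \<in> std_simplex d" "w \<in> std_simplex d" "0 \<le> s" "s \<le> 1"
  shows "mix s v w \<in> std_simplex d"
  using assms
  by (auto simp: std_simplex_def nonneg_orthant_def mix_def sum.distrib sum_distrib_left[symmetric])

lemma vol_det_exp_form:
  assumes w: "w \<in> pos_orthant d" and t: "t \<le> T"
  shows "vol_det t w = (\<Sum>f\<in>{0..<d-1} \<rightarrow>\<^sub>E idx t. (cb_weight (d - 1) tangent_coef f * (\<Prod>i=0..<d-1. wt (f i))) *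
     exp (- 2 * (\<Sum>i=0..<d-1. ln (ret (f i) w))))"
  unfolding vol_det_def gram_det_Cauchy_Binet[OF finite_idx]
proof (intro sum.cong refl)
  fix f assume f: "f \<in> {0..<d-1} \<rightarrow>\<^sub>E idx t"
  have "(\<Prod>i=0..<d-1. wt (f i) / (ret (f i) w)\<^sup>2) = (\<Prod>i=0..<d-1. wt (f i) * exp (- 2 * ln (ret (f i) w)))"
  proof (intro prod.cong refl)
    fix i assume "i \<in> {0..<d-1}"
    then have "f i \<in> idx T" using f idx_mono[OF t] by (auto dest: PiE_mem)
    then have "0 < ret (f i) w" using w by (rule ret_pos)
    then have "exp (- 2 * ln (ret (f i) w)) = 1 / (ret (f i) w)\<^sup>2"
      by (simp add: exp_minus exp_double divide_inverse)
    then show "wt (f i) / (ret (f i) w)\<^sup>2 = wt (f i) * exp (- 2 * ln (ret (f i) w))" by simp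
  qed
  then show "cb_weight (d - 1) tangent_coef f * (\<Prod>i=0..<d-1. wt (f i) / (ret (f i) w)\<^sup>2) =
      (cb_weight (d - 1) tangent_coef f * (\<Prod>i=0..<d-1. wt (f i))) * exp (- 2 * (\<Sum>i=0..<d-1. ln (ret (f i) w)))"
    by (simp add: prod.distrib exp_sum[symmetric] sum_distrib_left)
qed

lemma ln_vol_det_convex:
  assumes v: "v \<in> pos_orthant d" and w: "w \<in> pos_orthant d" and t: "t \<le> T" and s: "0 \<le> s" "s \<le> 1"
  shows "ln (vol_det t (mix s v w)) \<le> (1 - s) * ln (vol_det t v) + s * ln (vol_det t w)"
proof -
  have z: "mix s v w \<in> pos_orthant d" by (rule mix_pos[OF v w s])
  show ?thesis
    using vol_det_pos[OF v t] vol_det_pos[OF w t] vol_det_pos[OF z t]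
    unfolding vol_det_exp_form[OF v t] vol_det_exp_form[OF w t] vol_det_exp_form[OF z t]
  proof (rule log_sum_exp_convex[rotated 2, OF _ _ s])
    fix f assume f: "f \<in> {0..<d-1} \<rightarrow>\<^sub>E idx t"
    show "0 \<le> cb_weight (d - 1) tangent_coef f * (\<Prod>i=0..<d-1. wt (f i))"
      by (intro mult_nonneg_nonneg cb_weight_nonneg prod_nonneg) (auto simp: less_imp_le)
    have "(\<Sum>i=0..<d-1. (1 - s) * ln (ret (f i) v) + s * ln (ret (f i) w)) \<le> (\<Sum>i=0..<d-1. ln (ret (f i) (mix s v w)))"
    proof (rule sum_mono)
      fix i assume "i \<in> {0..<d-1}"
      then have "f i \<in> idx T" using f idx_mono[OF t] by (auto dest: PiE_mem)
      then have "0 < ret (f i) v" "0 < ret (f i) w" using v w ret_pos by auto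
      then show "(1 - s) * ln (ret (f i) v) + s * ln (ret (f i) w) \<le> ln (ret (f i) (mix s v w))"
        using concave_onD[OF ln_concave, of s "ret (f i) v" "ret (f i) w"] s by (simp add: ret_mix)
    qed
    then show "- 2 * (\<Sum>i=0..<d-1. ln (ret (f i) (mix s v w))) \<le>
        (1 - s) * (- 2 * (\<Sum>i=0..<d-1. ln (ret (f i) v))) + s * (- 2 * (\<Sum>i=0..<d-1. ln (ret (f i) w)))"
      unfolding sum.distrib sum_distrib_left[symmetric] by (simp add: algebra_simps)
  qed (auto intro: finite_PiE)
qed

section \<open>Stability of the minimizers\<close>

definition pot :: "real \<Rightarrow> nat \<Rightarrow> real Matrix.vec \<Rightarrow> real" where
  "pot mu t w = reg_loss d lam x t w + mu * vol_barrier d lam x t w"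

definition open_simplex :: "real Matrix.vec set" where
  "open_simplex = pos_orthant d \<inter> std_simplex d"

lemma pot_eq:
  assumes "w \<in> pos_orthant d" "t \<le> T"
  shows "pot mu t w = (\<Sum>k\<in>idx t. wt k * (- ln (ret k w))) + mu / 2 * ln (vol_det t w)"
  using assms by (simp add: pot_def reg_loss_eq vol_barrier_eq pos_orthant_def)

text \<open>
  Along the segment from \<open>v\<close> to \<open>w\<close> the volumetric term lies below its chord. Minimality of \<open>v\<close> at
  the point with parameter \<open>s\<close>, divided by \<open>s\<close>, therefore bounds a difference quotient of the
  logarithms by the increment \<open>\<Delta>\<close> of the volumetric term. In the limit \<open>s \<rightarrow> 0\<close> this becomes the first-order condition, in a
  form that needs the derivative of the logarithms only, and not that of the determinant.
\<close>

lemma minimizer_gap: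
  assumes mu: "0 < mu" and t: "t \<le> T" and v: "v \<in> open_simplex" and w: "w \<in> open_simplex"
    and min: "\<And>u. u \<in> open_simplex \<Longrightarrow> pot mu t v \<le> pot mu t u"
  shows "pot mu t v + (\<Sum>k\<in>idx t. wt k * log_gap (ret k w / ret k v)) \<le> pot mu t w"
proof -
  have vp: "v \<in> pos_orthant d" and wp: "w \<in> pos_orthant d" using v w by (auto simp: open_simplex_def)
  have rv: "0 < ret k v" and rw: "0 < ret k w" if "k \<in> idx t" for k
    using that ret_pos idx_mono[OF t] vp wp by blast+
  define \<Delta> where "\<Delta> = mu / 2 * (ln (vol_det t w) - ln (vol_det t v))"
  define g where "g s = (\<Sum>k\<in>idx t. wt k * ln (ret k v + s * (ret k w - ret k v)))" for s
  \<comment> \<open>The function \<open>g\<close> is minus the regularized loss along the segment.\<close>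
  have slope: "(g s - g 0) / (s - 0) \<le> \<Delta>" if s: "0 < s" "s < 1" for s
  proof -
    have z: "mix s v w \<in> open_simplex"
      using v w s by (auto simp: open_simplex_def mix_pos mix_simplex)
    then have zp: "mix s v w \<in> pos_orthant d" by (simp add: open_simplex_def)
    have "mu / 2 * ln (vol_det t (mix s v w)) \<le> mu / 2 * ((1 - s) * ln (vol_det t v) + s * ln (vol_det t w))"
      using ln_vol_det_convex[OF vp wp t] s mu by (intro mult_left_mono) auto
    moreover have "(\<Sum>k\<in>idx t. wt k * (- ln (ret k (mix s v w)))) = - g s"
      unfolding g_def sum_negf[symmetric] by (intro sum.cong refl) (simp add: ret_mix algebra_simps)
    moreover have "(\<Sum>k\<in>idx t. wt k * (- ln (ret k v))) = - g 0"
      unfolding g_def sum_negf[symmetric] by (intro sum.cong refl) simp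
    ultimately have "g s - g 0 \<le> s * \<Delta>"
      using min[OF z] unfolding pot_eq[OF vp t] pot_eq[OF zp t] \<Delta>_def by (simp add: algebra_simps)
    then show ?thesis using s by (simp add: pos_divide_le_eq mult.commute)
  qed
  have "(g has_real_derivative (\<Sum>k\<in>idx t. wt k * ((ret k w - ret k v) / ret k v))) (at 0)"
    unfolding g_def
  proof (rule DERIV_sum)
    fix k assume "k \<in> idx t"
    then show "((\<lambda>s. wt k * ln (ret k v + s * (ret k w - ret k v))) has_real_derivative
        wt k * ((ret k w - ret k v) / ret k v)) (at 0)"
      using rv by (auto intro!: derivative_eq_intros)
  qed
  then have lim: "((\<lambda>s. (g s - g 0) / (s - 0)) \<longlongrightarrow> (\<Sum>k\<in>idx t. wt k * ((ret k w - ret k v) / ret k v))) (at_right 0)"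
    unfolding has_field_derivative_iff by (rule filterlim_mono[OF _ order_refl at_le]) simp
  have "(\<Sum>k\<in>idx t. wt k * ((ret k w - ret k v) / ret k v)) \<le> \<Delta>"
  proof (rule tendsto_upperbound[OF lim])
    have "eventually (\<lambda>s::real. s \<in> {0<..<1}) (at_right 0)" by (rule eventually_at_right_real) simp
    then show "eventually (\<lambda>s. (g s - g 0) / (s - 0) \<le> \<Delta>) (at_right 0)"
      by eventually_elim (rule slope, auto)
  qed simp
  moreover have "(\<Sum>k\<in>idx t. wt k * log_gap (ret k w / ret k v)) =
      (\<Sum>k\<in>idx t. wt k * ((ret k w - ret k v) / ret k v)) +
      ((\<Sum>k\<in>idx t. wt k * (- ln (ret k w))) - (\<Sum>k\<in>idx t. wt k * (- ln (ret k v))))"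
    unfolding sum_subtractf[symmetric] sum.distrib[symmetric]
  proof (intro sum.cong refl)
    fix k assume "k \<in> idx t"
    then have gap_eq: "log_gap (ret k w / ret k v) = (ret k w - ret k v) / ret k v - ln (ret k w) + ln (ret k v)"
      using rv[of k] rw[of k] by (simp add: log_gap_def ln_div diff_divide_distrib)
    have "wt k * (X - a + b) = wt k * X + (wt k * (- a) - wt k * (- b))" for X a b
      by (simp add: algebra_simps)
    then show "wt k * log_gap (ret k w / ret k v) =
        wt k * ((ret k w - ret k v) / ret k v) + (wt k * (- ln (ret k w)) - wt k * (- ln (ret k v)))"
      unfolding gap_eq .
  qed
  ultimately show ?thesis
    unfolding pot_eq[OF vp t] pot_eq[OF wp t] \<Delta>_def by (simp add: algebra_simps)
qed

lemma sum_tangent_coef: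
  assumes "v \<in> std_simplex d" "w \<in> std_simplex d"
  shows "(\<Sum>i<d-1. tangent_coef k i * (vec_index w i - vec_index v i)) = ret k w - ret k v"
proof -
  define h where "h i = vec_index w i - vec_index v i" for i
  have h0: "(\<Sum>i<d. h i) = 0" using assms by (simp add: h_def sum_subtractf std_simplex_def)
  have "ret k w - ret k v = (\<Sum>i<d. coef k i * h i)"
    by (simp add: ret_def h_def sum_subtractf[symmetric] algebra_simps)
  also have "\<dots> = (\<Sum>i<d. coef k i * h i) - coef k (d - 1) * (\<Sum>i<d. h i)" using h0 by simp
  also have "\<dots> = (\<Sum>i<d. tangent_coef k i * h i)"
    by (simp add: tangent_coef_def left_diff_distrib sum_subtractf sum_distrib_left)
  also have "\<dots> = (\<Sum>i<Suc (d-1). tangent_coef k i * h i)" using d_pos by simp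
  also have "\<dots> = (\<Sum>i<d-1. tangent_coef k i * h i)" by (simp add: tangent_coef_def)
  finally show ?thesis by (simp add: h_def)
qed

text \<open>
  The ratio of two returns is an average of the ratios of the coordinates, with the share of
  coordinate \<open>i\<close> in the return of \<open>v\<close> as its weight.
\<close>

lemma ret_ratio_average:
  assumes k: "k \<in> idx T" and v: "v \<in> pos_orthant d"
  defines "p \<equiv> \<lambda>i. coef k i * vec_index v i / ret k v"
  shows "\<And>i. i \<in> {..<d} \<Longrightarrow> 0 \<le> p i" and "sum p {..<d} = 1"
    and "ret k w / ret k v = (\<Sum>i<d. p i * (vec_index w i / vec_index v i))"
proof -
  have rv: "0 < ret k v" by (rule ret_pos[OF k v])
  have vi: "0 < vec_index v i" if "i < d" for i using v that by (simp add: pos_orthant_def)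
  show "0 \<le> p i" if "i \<in> {..<d}" for i
    using that coef_nonneg[OF k, of i] vi[of i] rv by (simp add: p_def less_imp_le)
  show "sum p {..<d} = 1"
    using rv by (simp add: p_def sum_divide_distrib[symmetric] ret_def[symmetric])
  have "(\<Sum>i<d. p i * (vec_index w i / vec_index v i)) = (\<Sum>i<d. coef k i * vec_index w i / ret k v)"
  proof (intro sum.cong refl)
    fix i assume "i \<in> {..<d}"
    then have "vec_index v i \<noteq> 0" using vi[of i] by simp
    then show "p i * (vec_index w i / vec_index v i) = coef k i * vec_index w i / ret k v"
      by (simp add: p_def)
  qed
  then show "ret k w / ret k v = (\<Sum>i<d. p i * (vec_index w i / vec_index v i))"
    by (simp add: sum_divide_distrib[symmetric] ret_def[of k w])
qed

lemma idx_Suc: "idx (Suc t) = insert (Inr (Suc t)) (idx t)" "Inr (Suc t) \<notin> idx t"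
  by (auto simp: idx_def Plus_def atLeastAtMostSuc_conv)

lemma vol_det_Suc_mono:
  assumes "w \<in> pos_orthant d" "Suc t \<le> T"
  shows "vol_det t w \<le> vol_det (Suc t) w"
  unfolding vol_det_def by (rule gram_det_mono) (auto simp: idx_Suc less_imp_le)

text \<open>
  The rank-one estimate in the direction \<open>h = w - v\<close>. The vector \<open>h\<close> has sum \<open>0\<close>, so its first \<open>d - 1\<close>
  entries are its coordinates with respect to the columns of \<open>A\<close>.
\<close>

lemma vol_det_Suc_lower:
  assumes v: "v \<in> open_simplex" and w: "w \<in> open_simplex" and t: "Suc t \<le> T"
  defines "N \<equiv> \<Sum>k\<in>idx t. wt k * (1 - ret k v / ret k w)\<^sup>2"
  shows "vol_det t w * (N + (1 - ret (Inr (Suc t)) v / ret (Inr (Suc t)) w)\<^sup>2) \<le> vol_det (Suc t) w * N"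
proof -
  have wp: "w \<in> pos_orthant d" using w by (simp add: open_simplex_def)
  define h where "h i = vec_index w i - vec_index v i" for i
  have summand: "wt k / (ret k w)\<^sup>2 * (\<Sum>i<d-1. tangent_coef k i * h i)\<^sup>2 = wt k * (1 - ret k v / ret k w)\<^sup>2"
    if "k \<in> idx (Suc t)" for k
  proof -
    have "0 < ret k w" using that ret_pos wp idx_mono[OF t] by blast
    then have "1 - ret k v / ret k w = (ret k w - ret k v) / ret k w" by (simp add: diff_divide_distrib)
    then show ?thesis
      using sum_tangent_coef v w by (simp add: h_def open_simplex_def power_divide)
  qed
  have N: "(\<Sum>k\<in>idx t. wt k / (ret k w)\<^sup>2 * (\<Sum>i<d-1. tangent_coef k i * h i)\<^sup>2) = N"
    unfolding N_def using summand by (intro sum.cong refl) (auto simp: idx_Suc)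
  have "vol_det t w * (N + wt (Inr (Suc t)) / (ret (Inr (Suc t)) w)\<^sup>2 * (\<Sum>i<d-1. tangent_coef (Inr (Suc t)) i * h i)\<^sup>2)
      \<le> vol_det (Suc t) w * N"
    using gram_det_insert_lower[of "idx t" "Inr (Suc t)" "\<lambda>k. wt k / (ret k w)\<^sup>2" "d - 1" tangent_coef h]
      vol_det_pos[OF wp, of t] t
    unfolding N vol_det_def idx_Suc(1) by (simp add: idx_Suc(2) less_imp_le)
  then show ?thesis using summand[of "Inr (Suc t)"] by (simp add: idx_Suc)
qed

text \<open>
  The minimal potential grows by at least the loss suffered in the round. If the divergence \<open>B\<close>
  already exceeds \<open>ln r\<close>, it suffices that the determinant does not decrease. Otherwise \<open>w\<close> is so close
  to \<open>v\<close> that the rank-one increase of the determinant pays for the rest.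
\<close>

lemma stability:
  assumes params: "27 / 2 \<le> lam" "8 / 5 * (1 + 16 / (5 * lam))\<^sup>2 \<le> mu" "0 < mu"
    and t: "Suc t \<le> T" and v: "v \<in> open_simplex" and w: "w \<in> open_simplex"
    and min: "\<And>u. u \<in> open_simplex \<Longrightarrow> pot mu t v \<le> pot mu t u"
  shows "pot mu t v - ln (ret (Inr (Suc t)) v) \<le> pot mu (Suc t) w"
proof -
  let ?x = "Inr (Suc t)"
  have vp: "v \<in> pos_orthant d" and wp: "w \<in> pos_orthant d" using v w by (auto simp: open_simplex_def)
  have t': "t \<le> T" using t by simp
  have xT: "?x \<in> idx T" using t by (auto simp: idx_def)
  have vi: "0 < vec_index v i" and wi: "0 < vec_index w i" if "i < d" for i
    using vp wp that by (auto simp: pos_orthant_def)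
  have rv: "0 < ret k v" and rw: "0 < ret k w" if "k \<in> idx T" for k using that ret_pos vp wp by auto
  have sub: "idx t \<subseteq> idx T" by (rule idx_mono[OF t'])
  define r where "r = ret ?x w / ret ?x v"
  define B where "B = (\<Sum>k\<in>idx t. wt k * log_gap (ret k w / ret k v))"
  define N where "N = (\<Sum>k\<in>idx t. wt k * (1 - ret k v / ret k w)\<^sup>2)"
  have r0: "0 < r" using rv[OF xT] rw[OF xT] by (simp add: r_def)
  have r_inv: "1 - ret ?x v / ret ?x w = 1 - 1 / r" by (simp add: r_def)
  have pp: "0 \<le> log_gap (ret k w / ret k v)" if "k \<in> idx T" for k
    using rv[OF that] rw[OF that] by (intro log_gap_nonneg) simp
  have B0: "0 \<le> B" unfolding B_def using pp sub by (intro sum_nonneg mult_nonneg_nonneg) (auto simp: less_imp_le)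
  have gap: "pot mu t v + B \<le> pot mu t w"
    unfolding B_def by (rule minimizer_gap[OF params(3) t' v w min])
  have coord: "(\<Sum>i<d. lam * log_gap (vec_index w i / vec_index v i)) \<le> B"
    unfolding B_def sum_idx using pp sub
    by (auto intro!: sum_nonneg simp: idx_def)
  have gap_r: "lam * log_gap r \<le> B"
  proof -
    have "log_gap r \<le> (\<Sum>i<d. log_gap (vec_index w i / vec_index v i))"
      by (rule log_gap_average_le[where p = "\<lambda>i. coef ?x i * vec_index v i / ret ?x v"])
         (use ret_ratio_average(1,2)[OF xT vp] ret_ratio_average(3)[OF xT vp, of w] r0 vi wi in \<open>auto simp: r_def\<close>)
    then have "lam * log_gap r \<le> lam * (\<Sum>i<d. log_gap (vec_index w i / vec_index v i))"
      using lam_pos by (intro mult_left_mono) auto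
    then show ?thesis using coord by (simp add: sum_distrib_left)
  qed
  \<comment> \<open>The same averaging with the roles of \<open>v\<close> and \<open>w\<close> exchanged, for the reciprocal ratios.\<close>
  have N_r: "lam * (1 - 1 / r)\<^sup>2 \<le> N"
  proof -
    have avg: "ret ?x v / ret ?x w = (\<Sum>i<d. coef ?x i * vec_index w i / ret ?x w * (vec_index v i / vec_index w i))"
      by (rule ret_ratio_average(3)[OF xT wp])
    have "1 - ret ?x v / ret ?x w =
        (\<Sum>i<d. coef ?x i * vec_index w i / ret ?x w * (1 - vec_index v i / vec_index w i))"
      unfolding avg right_diff_distrib sum_subtractf using ret_ratio_average(2)[OF xT wp] by simp
    then have "(1 - ret ?x v / ret ?x w)\<^sup>2 \<le> (\<Sum>i<d. (1 - vec_index v i / vec_index w i)\<^sup>2)"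
      using square_average_le[of "{..<d}" "\<lambda>i. coef ?x i * vec_index w i / ret ?x w" "\<lambda>i. 1 - vec_index v i / vec_index w i"]
        ret_ratio_average(1,2)[OF xT wp] by simp
    then have "lam * (1 - 1 / r)\<^sup>2 \<le> lam * (\<Sum>i<d. (1 - vec_index v i / vec_index w i)\<^sup>2)"
      unfolding r_inv using lam_pos by (intro mult_left_mono) auto
    also have "\<dots> \<le> N" unfolding N_def sum_idx
      by (auto intro!: sum_nonneg simp: sum_distrib_left)
    finally show ?thesis .
  qed
  have goal: "ln r \<le> B + mu / 2 * (ln (vol_det (Suc t) w) - ln (vol_det t w))"
  proof (cases "B < ln r")
    case False
    have "ln (vol_det t w) \<le> ln (vol_det (Suc t) w)"
      using vol_det_Suc_mono[OF wp t] vol_det_pos[OF wp t'] by (intro ln_mono) auto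
    then have "0 \<le> mu / 2 * (ln (vol_det (Suc t) w) - ln (vol_det t w))" using params(3) by simp
    then show ?thesis using False by linarith
  next
    case True
    note small = small_divergence_ratio[OF params(1) r0 gap_r True]
    define \<rho> where "\<rho> = 1 - 201 / (100 * lam)"
    have \<rho>: "0 < \<rho>" "\<rho> \<le> 1" using params(1) by (auto simp: \<rho>_def field_simps)
    have ratio_i: "\<rho> * vec_index v i \<le> vec_index w i" if i: "i < d" for i
    proof -
      have "lam * log_gap (vec_index w i / vec_index v i) \<le> (\<Sum>i<d. lam * log_gap (vec_index w i / vec_index v i))"
        using i vi wi lam_pos log_gap_nonneg by (intro member_le_sum) auto
      then have "\<rho> \<le> vec_index w i / vec_index v i"
        unfolding \<rho>_def using vi[OF i] wi[OF i] coord
        by (intro small_divergence_lower[OF params(1) _ _ small(3)]) auto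
      then show ?thesis using vi[OF i] by (simp add: pos_le_divide_eq)
    qed
    have ratio: "\<rho> \<le> ret k w / ret k v" if k: "k \<in> idx T" for k
    proof -
      have "\<rho> * ret k v = (\<Sum>i<d. coef k i * (\<rho> * vec_index v i))"
        unfolding ret_def sum_distrib_left by (intro sum.cong refl) simp
      also have "\<dots> \<le> ret k w"
        unfolding ret_def using ratio_i coef_nonneg[OF k] by (intro sum_mono mult_left_mono) auto
      finally show ?thesis using rv[OF k] by (simp add: pos_le_divide_eq)
    qed
    have NB: "\<rho>\<^sup>2 * N \<le> 2 * B"
      unfolding N_def B_def sum_distrib_left
    proof (rule sum_mono)
      fix k assume "k \<in> idx t"
      then have k: "k \<in> idx T" using sub by auto
      have "\<rho>\<^sup>2 * (1 - 1 / (ret k w / ret k v))\<^sup>2 \<le> 2 * log_gap (ret k w / ret k v)"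
        by (rule log_gap_lower_local_norm[OF \<rho> ratio[OF k]])
      then have "wt k * (\<rho>\<^sup>2 * (1 - ret k v / ret k w)\<^sup>2) \<le> wt k * (2 * log_gap (ret k w / ret k v))"
        by (intro mult_left_mono) (auto simp: less_imp_le)
      then show "\<rho>\<^sup>2 * (wt k * (1 - ret k v / ret k w)\<^sup>2) \<le> 2 * (wt k * log_gap (ret k w / ret k v))"
        by (simp add: mult_ac)
    qed
    have "ln r \<le> B + mu / 2 * ln (1 + (1 - 1 / r)\<^sup>2 / N)"
      by (rule divergence_log_tradeoff[OF params(1,2) r0 gap_r True N_r NB[unfolded \<rho>_def]])
    also have "ln (1 + (1 - 1 / r)\<^sup>2 / N) \<le> ln (vol_det (Suc t) w) - ln (vol_det t w)"
    proof -
      have "0 < lam * (1 - 1 / r)\<^sup>2" using lam_pos small(1) by simp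
      then have N0: "0 < N" using N_r by linarith
      have "vol_det t w * (N + (1 - 1 / r)\<^sup>2) \<le> vol_det (Suc t) w * N"
        using vol_det_Suc_lower[OF v w t] by (simp only: N_def r_inv)
      then have "vol_det t w * (1 + (1 - 1 / r)\<^sup>2 / N) \<le> vol_det (Suc t) w"
        using N0 by (simp add: field_simps)
      moreover have pos: "0 < 1 + (1 - 1 / r)\<^sup>2 / N" using N0 by (intro add_pos_nonneg) auto
      ultimately have "ln (vol_det t w * (1 + (1 - 1 / r)\<^sup>2 / N)) \<le> ln (vol_det (Suc t) w)"
        using vol_det_pos[OF wp t'] by (intro ln_mono) auto
      then show ?thesis using ln_mult_pos[OF vol_det_pos[OF wp t'] pos] by linarith
    qed
    finally show ?thesis using params(3) by (simp add: mult_left_mono)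
  qed
  have "pot mu (Suc t) w = pot mu t w - ln (ret ?x w) + mu / 2 * (ln (vol_det (Suc t) w) - ln (vol_det t w))"
    unfolding pot_eq[OF wp t] pot_eq[OF wp t'] idx_Suc(1) by (simp add: idx_Suc(2) algebra_simps)
  moreover have "ln r = ln (ret ?x w) - ln (ret ?x v)"
    using rv[OF xT] rw[OF xT] by (simp add: r_def ln_div)
  ultimately show ?thesis using gap goal by linarith
qed

section \<open>The potential at a smoothed comparator\<close>

definition unif :: "real Matrix.vec" where
  "unif = Matrix.vec d (\<lambda>_. 1 / real d)"

lemma unif_open_simplex: "unif \<in> open_simplex"
  using d_pos by (auto simp: unif_def open_simplex_def pos_orthant_def std_simplex_def nonneg_orthant_def)

lemma std_simplex_le_one:
  assumes "w \<in> std_simplex d" "i < d"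
  shows "vec_index w i \<le> 1"
  using assms member_le_sum[of i "{..<d}" "vec_index w"]
  by (auto simp: std_simplex_def nonneg_orthant_def)

text \<open>
  Crude but sufficient: every entry of the matrix is at most \<open>(T + 2 \<lambda>) / c\<^sup>2\<close>, and the Leibniz formula has
  \<open>n! \<le> n\<^sup>n\<close> terms. Each loss contributes at most \<open>1 / c\<^sup>2\<close> because \<open>x \<cdot> w\<close> is at least \<open>c\<close> times every entry
  of \<open>x\<close>. To a given entry, the barrier contributes through two coordinates at most.
\<close>

lemma vol_det_upper:
  assumes w: "w \<in> pos_orthant d" and c: "0 < c" "\<And>i. i < d \<Longrightarrow> c \<le> vec_index w i"
  shows "vol_det T w \<le> (real (d - 1) * ((real T + 2 * lam) / c\<^sup>2)) ^ (d - 1)"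
proof -
  define n where "n = d - 1"
  define m where "m = (real T + 2 * lam) / c\<^sup>2"
  have m0: "0 \<le> m" using lam_pos by (simp add: m_def)
  define M where "M = Matrix.mat n n (\<lambda>(i, j). \<Sum>k\<in>idx T. wt k / (ret k w)\<^sup>2 * (tangent_coef k i * tangent_coef k j))"
  have entry: "\<bar>M $$ (i, j)\<bar> \<le> m" if ij: "i < n" "j < n" for i j
  proof -
    have coord: "\<bar>wt (Inl l) / (ret (Inl l) w)\<^sup>2 * (tangent_coef (Inl l) i * tangent_coef (Inl l) j)\<bar> \<le>
        (if l = i then lam / c\<^sup>2 else 0) + (if l = d - 1 then lam / c\<^sup>2 else 0)" if l: "l < d" for l
    proof -
      have "lam / (vec_index w l)\<^sup>2 \<le> lam / c\<^sup>2"
        using c l lam_pos by (intro divide_left_mono power_mono mult_pos_pos zero_less_power) (auto intro: less_le_trans)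
      moreover have "0 \<le> lam / (vec_index w l)\<^sup>2" using lam_pos by simp
      ultimately show ?thesis using l ij lam_pos by (auto simp: tangent_coef_def n_def)
    qed
    have loss: "\<bar>wt (Inr \<tau>) / (ret (Inr \<tau>) w)\<^sup>2 * (tangent_coef (Inr \<tau>) i * tangent_coef (Inr \<tau>) j)\<bar> \<le> 1 / c\<^sup>2"
      if \<tau>: "\<tau> \<in> {1..T}" for \<tau>
    proof -
      let ?k = "Inr \<tau> :: nat + nat"
      have k: "?k \<in> idx T" using \<tau> by (auto simp: idx_def)
      have rk: "0 < ret ?k w" by (rule ret_pos[OF k w])
      have ub: "c * coef ?k l \<le> ret ?k w" if l: "l < d" for l
      proof -
        have "c * coef ?k l \<le> coef ?k l * vec_index w l"
          using mult_left_mono[OF c(2)[OF l] coef_nonneg[OF k l]] by (simp only: mult.commute)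
        also have "\<dots> \<le> ret ?k w" unfolding ret_def
          using l coef_nonneg[OF k] w
          by (intro member_le_sum[of l "{..<d}" "\<lambda>l. coef ?k l * vec_index w l"])
             (auto simp: pos_orthant_def less_imp_le)
        finally show ?thesis .
      qed
      have pb: "c * \<bar>tangent_coef ?k l\<bar> \<le> ret ?k w" if "l < n" for l
      proof -
        have l: "l < d" "d - 1 < d" using that d_pos by (auto simp: n_def)
        have "\<bar>tangent_coef ?k l\<bar> \<le> max (coef ?k l) (coef ?k (d - 1))"
          using coef_nonneg[OF k l(1)] coef_nonneg[OF k l(2)] by (auto simp: tangent_coef_def)
        then have "c * \<bar>tangent_coef ?k l\<bar> \<le> c * max (coef ?k l) (coef ?k (d - 1))"
          using c(1) by (intro mult_left_mono) auto
        also have "\<dots> \<le> ret ?k w" using ub[OF l(1)] ub[OF l(2)] by (simp add: max_def)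
        finally show ?thesis .
      qed
      have "(c * \<bar>tangent_coef ?k i\<bar>) * (c * \<bar>tangent_coef ?k j\<bar>) \<le> ret ?k w * ret ?k w"
        using pb ij c(1) rk by (intro mult_mono) auto
      then have "c\<^sup>2 * (\<bar>tangent_coef ?k i\<bar> * \<bar>tangent_coef ?k j\<bar>) \<le> (ret ?k w)\<^sup>2" by (simp add: power2_eq_square mult_ac)
      then have "(\<bar>tangent_coef ?k i\<bar> * \<bar>tangent_coef ?k j\<bar>) / (ret ?k w)\<^sup>2 \<le> 1 / c\<^sup>2"
        using rk c(1) by (simp add: field_simps)
      then show ?thesis by (simp add: abs_mult)
    qed
    have "\<bar>M $$ (i, j)\<bar> \<le> (\<Sum>k\<in>idx T. \<bar>wt k / (ret k w)\<^sup>2 * (tangent_coef k i * tangent_coef k j)\<bar>)"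
    proof -
      have "M $$ (i, j) = (\<Sum>k\<in>idx T. wt k / (ret k w)\<^sup>2 * (tangent_coef k i * tangent_coef k j))"
        using ij by (simp add: M_def)
      then show ?thesis by (simp only: sum_abs)
    qed
    also have "\<dots> = (\<Sum>l<d. \<bar>wt (Inl l) / (ret (Inl l) w)\<^sup>2 * (tangent_coef (Inl l) i * tangent_coef (Inl l) j)\<bar>) +
        (\<Sum>\<tau>\<in>{1..T}. \<bar>wt (Inr \<tau>) / (ret (Inr \<tau>) w)\<^sup>2 * (tangent_coef (Inr \<tau>) i * tangent_coef (Inr \<tau>) j)\<bar>)"
      by (rule sum_idx)
    also have "\<dots> \<le> (\<Sum>l<d. (if l = i then lam / c\<^sup>2 else 0) + (if l = d - 1 then lam / c\<^sup>2 else 0)) +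
        (\<Sum>\<tau>\<in>{1..T}. 1 / c\<^sup>2)"
      using coord loss by (intro add_mono sum_mono) auto
    also have "\<dots> = m" using ij d_pos by (simp add: sum.distrib n_def m_def add_divide_distrib)
    finally show ?thesis .
  qed
  have "vol_det T w = Determinant.det M" by (simp add: vol_det_def gram_det_def M_def n_def)
  also have "\<dots> \<le> fact n * m ^ n" by (rule det_le_fact_power[OF _ entry]) (auto simp: M_def)
  also have "\<dots> \<le> real n ^ n * m ^ n"
    using m0 fact_le_power[of n, where 'a = real] by (intro mult_right_mono) auto
  finally show ?thesis by (simp only: power_mult_distrib n_def m_def)
qed

lemma ln_vol_det_0_lower:
  assumes w: "w \<in> open_simplex"
  shows "real (d - 1) * ln lam \<le> ln (vol_det 0 w)"
proof -
  have wp: "w \<in> pos_orthant d" and ws: "w \<in> std_simplex d" using w by (auto simp: open_simplex_def)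
  have "lam ^ (d - 1) = (\<Prod>m<d-1. lam)" by simp
  also have "\<dots> \<le> (\<Prod>m<d-1. lam / (vec_index w m)\<^sup>2)"
  proof (rule prod_mono)
    fix m assume "m \<in> {..<d-1}"
    then have m: "0 < vec_index w m" "vec_index w m \<le> 1"
      using wp std_simplex_le_one[OF ws] by (auto simp: pos_orthant_def)
    then have "(vec_index w m)\<^sup>2 \<le> 1" by (simp add: power_le_one)
    then show "0 \<le> lam \<and> lam \<le> lam / (vec_index w m)\<^sup>2"
      using m lam_pos by (simp add: pos_le_divide_eq mult_left_le)
  qed
  also have "\<dots> \<le> vol_det 0 w" by (rule vol_det_lower[OF wp]) simp
  finally have "ln (lam ^ (d - 1)) \<le> ln (vol_det 0 w)" using lam_pos by (intro ln_mono) auto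
  then show ?thesis using lam_pos by (simp add: ln_realpow)
qed

lemma sum_ln_le_uniform:
  assumes w: "w \<in> open_simplex"
  shows "(\<Sum>i<d. ln (vec_index w i)) \<le> - real d * ln (real d)"
proof -
  have "(\<Sum>i<d. ln (vec_index w i) + ln (real d)) \<le> (\<Sum>i<d. real d * vec_index w i - 1)"
  proof (rule sum_mono)
    fix i assume "i \<in> {..<d}"
    then have wi: "0 < vec_index w i" using w by (auto simp: open_simplex_def pos_orthant_def)
    have "ln (vec_index w i) + ln (real d) = ln (real d * vec_index w i)"
      using wi d_pos by (subst ln_mult_pos) auto
    also have "\<dots> \<le> real d * vec_index w i - 1" using wi d_pos by (intro ln_le_minus_one) simp
    finally show "ln (vec_index w i) + ln (real d) \<le> real d * vec_index w i - 1" .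
  qed
  also have "\<dots> = real d * (\<Sum>i<d. vec_index w i) - real d"
    by (simp add: sum_subtractf sum_distrib_left)
  also have "\<dots> = 0" using w by (simp add: open_simplex_def std_simplex_def)
  finally show ?thesis by (simp add: sum.distrib)
qed

text \<open>
  Among the points of the simplex with all entries at least \<open>\<alpha> / d\<close> the product of the entries is
  smallest at a vertex, where \<open>d - 1\<close> entries equal \<open>\<alpha> / d\<close> and the last one is at least \<open>1 / d\<close>. This is
  why only \<open>d - 1\<close>, and not \<open>d\<close>, logarithms of \<open>1/\<alpha>\<close> are lost. The proof applies Weierstrass' inequality
  to the normalized entries \<open>1 + z\<^sub>i = w\<^sub>i d / \<alpha>\<close>.
\<close>

lemma sum_ln_lower:
  assumes w: "w \<in> std_simplex d" and \<alpha>: "0 < \<alpha>" "\<alpha> \<le> 1" "\<And>i. i < d \<Longrightarrow> \<alpha> / real d \<le> vec_index w i"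
  shows "- real d * ln (real d) - real (d - 1) * ln (1 / \<alpha>) \<le> (\<Sum>i<d. ln (vec_index w i))"
proof -
  define z where "z i = vec_index w i * (real d / \<alpha>) - 1" for i
  have d0: "0 < real d" using d_pos by simp
  have wi: "0 < vec_index w i" if "i < d" for i

  proof -
    have "0 < \<alpha> / real d" using \<alpha>(1) d0 by simp
    then show ?thesis using \<alpha>(3)[OF that] by linarith
  qed
  have z0: "0 \<le> z i" if "i \<in> {..<d}" for i
    using \<alpha>(3)[of i] that \<alpha>(1) d0 by (simp add: z_def field_simps)
  have sz: "sum z {..<d} = real d / \<alpha> - real d"
  proof -
    have "sum z {..<d} = (\<Sum>i<d. vec_index w i) * (real d / \<alpha>) - real d"
      unfolding z_def sum_subtractf sum_distrib_right by simp
    then show ?thesis using w by (simp add: std_simplex_def)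
  qed
  \<comment> \<open>This product is the amount by which \<open>1 + sum z {..<d} = 1 + d / \<alpha> - d\<close> exceeds \<open>1 / \<alpha>\<close>.\<close>
  have "0 \<le> (real d - 1) * (1 / \<alpha> - 1)" using d_pos \<alpha> by simp
  then have "1 / \<alpha> \<le> 1 + sum z {..<d}" unfolding sz by (simp add: algebra_simps)
  then have "ln (1 / \<alpha>) \<le> ln (1 + sum z {..<d})" using \<alpha>(1) by (intro ln_mono) auto
  also have "\<dots> \<le> (\<Sum>i<d. ln (1 + z i))" by (rule ln_one_plus_sum_le[OF _ z0]) auto
  also have "\<dots> = (\<Sum>i<d. ln (vec_index w i) + (ln (real d) + ln (1 / \<alpha>)))"
  proof (intro sum.cong refl)
    fix i assume "i \<in> {..<d}"
    then have "0 < vec_index w i" using wi by simp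
    then have "ln (vec_index w i * (real d * (1 / \<alpha>))) = ln (vec_index w i) + (ln (real d) + ln (1 / \<alpha>))"
      using d0 \<alpha>(1) by (subst ln_mult_pos, simp, simp, subst ln_mult_pos) auto
    then show "ln (1 + z i) = ln (vec_index w i) + (ln (real d) + ln (1 / \<alpha>))" by (simp add: z_def)
  qed
  also have "\<dots> = (\<Sum>i<d. ln (vec_index w i)) + real d * (ln (real d) + ln (1 / \<alpha>))"
    by (simp add: sum.distrib)
  finally show ?thesis using d_pos by (simp add: of_nat_diff algebra_simps)
qed

text \<open>
  The weight \<open>\<alpha> = \<lambda> n / (T + \<lambda> n)\<close> of the uniform portfolio keeps the loss of mixing, \<open>- T ln (1 - \<alpha>)\<close>, below
  \<open>\<lambda> n\<close>. Together with the barrier this makes \<open>\<lambda> n (1 + ln (1/\<alpha>)) = \<lambda> n ln (e (T + \<lambda> n) / (\<lambda> n))\<close>, which is at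
  most \<open>\<lambda> n ln (T + \<lambda> n)\<close> since \<open>\<lambda> n \<ge> e\<close>. In the volumetric term, the quotient of the
  two determinants is at most \<open>(T + \<lambda> d)\<^sup>4\<^sup>n\<close>.
\<close>

lemma pot_comparator:
  assumes params: "27 / 2 \<le> lam" "0 < mu" and d2: "2 \<le> d" and T1: "1 \<le> T"
    and v: "v \<in> open_simplex"
    and u: "u \<in> std_simplex d" "\<And>\<tau>. \<tau> \<in> {1..T} \<Longrightarrow> 0 < ret (Inr \<tau>) u"
  shows "\<exists>w\<in>open_simplex. pot mu T w - pot mu 0 v \<le>
    (\<Sum>\<tau>\<in>{1..T}. - ln (ret (Inr \<tau>) u)) + (lam + 2 * mu) * (real d - 1) * ln (real T + lam * real d)"
proof -
  define n where "n = real (d - 1)"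
  define \<alpha> where "\<alpha> = lam * n / (real T + lam * n)"
  define X where "X = real T + lam * real d"
  define w where "w = mix \<alpha> u unif"
  have n1: "1 \<le> n" and dn: "real d = n + 1" using d2 by (auto simp: n_def of_nat_diff)
  have T0: "1 \<le> real T" using T1 by simp
  have ln0: "0 < lam * n" using n1 lam_pos by simp
  have \<alpha>: "0 < \<alpha>" "\<alpha> < 1" using ln0 T0 by (auto simp: \<alpha>_def pos_divide_less_eq)
  have inv\<alpha>: "1 / \<alpha> = (real T + lam * n) / (lam * n)" by (simp add: \<alpha>_def)
  have one\<alpha>: "1 - \<alpha> = real T / (real T + lam * n)" using ln0 T0 by (simp add: \<alpha>_def field_simps)
  have us: "unif \<in> std_simplex d" and up: "unif \<in> pos_orthant d"
    using unif_open_simplex by (auto simp: open_simplex_def)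
  have wi: "\<alpha> / real d \<le> vec_index w i" if "i < d" for i
    using that \<alpha> u by (simp add: w_def mix_def unif_def std_simplex_def nonneg_orthant_def)
  have wi0: "0 < vec_index w i" if "i < d" for i
  proof -
    have "0 < \<alpha> / real d" using \<alpha> d_pos by simp
    then show ?thesis using wi[OF that] by linarith
  qed
  have ws: "w \<in> std_simplex d" unfolding w_def using \<alpha> by (intro mix_simplex u us) auto
  have wp: "w \<in> pos_orthant d" using wi0 by (auto simp: pos_orthant_def w_def)
  have wo: "w \<in> open_simplex" using ws wp by (simp add: open_simplex_def)
  have vp: "v \<in> pos_orthant d" using v by (simp add: open_simplex_def)
  have X_ge: "real T + lam * n \<le> X" "real T + 2 * lam \<le> X" "real d * lam \<le> X"
  proof -
    have "lam * 2 \<le> lam * real d" "lam * n \<le> lam * real d"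
      using d2 dn lam_pos by (auto intro!: mult_left_mono)
    then show "real T + lam * n \<le> X" "real T + 2 * lam \<le> X" "real d * lam \<le> X"
      using T0 by (simp_all add: X_def mult.commute)
  qed
  have X0: "0 < X"
  proof -
    have "0 < real d * lam" using lam_pos d_pos by simp
    then show ?thesis using X_ge(3) by linarith
  qed
  have loss: "(\<Sum>\<tau>\<in>{1..T}. - ln (ret (Inr \<tau>) w)) \<le> (\<Sum>\<tau>\<in>{1..T}. - ln (ret (Inr \<tau>) u)) + lam * n"
  proof -
    have "(\<Sum>\<tau>\<in>{1..T}. - ln (ret (Inr \<tau>) w)) \<le> (\<Sum>\<tau>\<in>{1..T}. - ln (ret (Inr \<tau>) u) - ln (1 - \<alpha>))"
    proof (rule sum_mono)
      fix \<tau> assume \<tau>: "\<tau> \<in> {1..T}"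
      have k: "Inr \<tau> \<in> idx T" using \<tau> by (auto simp: idx_def)
      have "(1 - \<alpha>) * ret (Inr \<tau>) u \<le> ret (Inr \<tau>) w"
        unfolding w_def ret_mix using \<alpha> ret_pos[OF k up] by simp
      then have "ln ((1 - \<alpha>) * ret (Inr \<tau>) u) \<le> ln (ret (Inr \<tau>) w)"
        using \<alpha> u(2)[OF \<tau>] by (intro ln_mono) auto
      moreover have "ln ((1 - \<alpha>) * ret (Inr \<tau>) u) = ln (1 - \<alpha>) + ln (ret (Inr \<tau>) u)"
        using \<alpha> u(2)[OF \<tau>] by (intro ln_mult_pos) auto
      ultimately show "- ln (ret (Inr \<tau>) w) \<le> - ln (ret (Inr \<tau>) u) - ln (1 - \<alpha>)" by simp
    qed
    also have "\<dots> = (\<Sum>\<tau>\<in>{1..T}. - ln (ret (Inr \<tau>) u)) - real T * ln (1 - \<alpha>)"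
      by (simp add: sum_subtractf)
    also have "- ln (1 - \<alpha>) = ln (1 + lam * n / real T)"
    proof -
      have "1 / (1 - \<alpha>) = 1 + lam * n / real T" using T0 unfolding one\<alpha> by (simp add: field_simps)
      moreover have "ln (1 / (1 - \<alpha>)) = - ln (1 - \<alpha>)" using \<alpha> by (simp add: ln_div)
      ultimately show ?thesis by simp
    qed
    then have "- (real T * ln (1 - \<alpha>)) \<le> lam * n"
    proof -
      assume eq: "- ln (1 - \<alpha>) = ln (1 + lam * n / real T)"
      have "real T * ln (1 + lam * n / real T) \<le> real T * (lam * n / real T)"
        using ln0 T0 by (intro mult_left_mono ln_add_one_self_le_self) auto
      then show ?thesis using T0 eq by (simp add: minus_mult_right)
    qed
    ultimately show ?thesis by linarith
  qed
  have barrier: "lam * (\<Sum>i<d. - ln (vec_index w i)) - lam * (\<Sum>i<d. - ln (vec_index v i)) \<le> lam * (n * ln (1 / \<alpha>))"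
  proof -
    have "(\<Sum>i<d. - ln (vec_index w i)) - (\<Sum>i<d. - ln (vec_index v i)) \<le> n * ln (1 / \<alpha>)"
      using sum_ln_lower[OF ws \<alpha>(1) less_imp_le[OF \<alpha>(2)] wi] sum_ln_le_uniform[OF v]
      by (simp add: sum_negf n_def)
    then show ?thesis using lam_pos by (simp add: right_diff_distrib[symmetric])
  qed
  have volume: "ln (vol_det T w) - ln (vol_det 0 v) \<le> n * (4 * ln X)"
  proof -
    define m where "m = n * ((real T + 2 * lam) / (\<alpha> / real d)\<^sup>2)"
    have m0: "0 < m" using n1 lam_pos \<alpha> d_pos T0 by (simp add: m_def add_pos_pos)
    have "vol_det T w \<le> m ^ (d - 1)"
      using vol_det_upper[OF wp _ wi] \<alpha> d_pos by (simp add: m_def n_def)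
    then have "ln (vol_det T w) \<le> ln (m ^ (d - 1))" using vol_det_pos[OF wp] by (intro ln_mono) auto
    also have "\<dots> = n * ln m" using m0 by (simp add: ln_realpow n_def)
    finally have "ln (vol_det T w) - ln (vol_det 0 v) \<le> n * ln m - n * ln lam" using ln_vol_det_0_lower[OF v] by (simp add: n_def)
    also have "\<dots> = n * ln (m / lam)" using m0 lam_pos by (simp add: ln_div right_diff_distrib)
    also have "\<dots> \<le> n * ln (X ^ 4)"
    proof (intro mult_left_mono ln_mono)
      have "m / lam = (real T + 2 * lam) * (real T + lam * n)\<^sup>2 * ((real d)\<^sup>2 / (lam ^ 3 * n))"
      proof -
        have "a * (P * Q * (Z / (l * a))\<^sup>2) / l = P * Z\<^sup>2 * (Q / (l ^ 3 * a))" if "0 < a" "0 < l" for a l P Q Z :: real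
          using that by (simp add: power2_eq_square power3_eq_cube field_simps)
        moreover have "m = n * ((real T + 2 * lam) * (real d)\<^sup>2 * (1 / \<alpha>)\<^sup>2)"
          by (simp add: m_def power_divide)
        ultimately show ?thesis using n1 lam_pos unfolding inv\<alpha> by simp
      qed
      also have "\<dots> \<le> X * X\<^sup>2 * X"
      proof (intro mult_mono power_mono)
        have "real d \<le> 2 * n" using n1 dn by simp
        then have "(real d)\<^sup>2 \<le> real d * (2 * n)" by (simp add: power2_eq_square mult_left_mono)
        also have "\<dots> \<le> X * (lam ^ 3 * n)"
        proof -
          have "2 \<le> lam ^ 4" using params(1) power_mono[of 2 lam 4] by simp
          then have "real d * n * 2 \<le> real d * n * lam ^ 4" using n1 by (intro mult_left_mono) auto
          also have "\<dots> = (real d * lam) * (lam ^ 3 * n)" by (simp add: power_numeral_reduce)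
          also have "\<dots> \<le> X * (lam ^ 3 * n)" using X_ge(3) lam_pos n1 by (intro mult_right_mono) auto
          finally show ?thesis by (simp add: mult_ac)
        qed
        finally show "(real d)\<^sup>2 / (lam ^ 3 * n) \<le> X" using lam_pos n1 by (simp add: pos_divide_le_eq)
      qed (use X_ge X0 lam_pos n1 in auto)
      also have "\<dots> = X ^ 4" by (simp add: power2_eq_square power_numeral_reduce mult_ac)
      finally show "m / lam \<le> X ^ 4" .
    qed (use m0 lam_pos n1 in auto)
    finally show ?thesis using X0 by (simp add: ln_realpow)
  qed
  have log: "1 + ln (1 / \<alpha>) \<le> ln X"
  proof -
    have "exp 1 \<le> lam * n"
    proof -
      have "exp 1 \<le> (3 :: real)" by (rule exp_le)
      moreover have "lam * 1 \<le> lam * n" using n1 lam_pos by (intro mult_left_mono) auto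
      ultimately show ?thesis using params(1) by linarith
    qed
    then have "exp 1 * (real T + lam * n) \<le> (lam * n) * (real T + lam * n)"
      using ln0 T0 by (intro mult_right_mono) auto
    then have "exp 1 * (1 / \<alpha>) \<le> real T + lam * n"
      unfolding inv\<alpha> using ln0 by (simp add: pos_divide_le_eq mult.commute)
    then have "ln (exp 1 * (1 / \<alpha>)) \<le> ln X" using X_ge(1) \<alpha>(1) by (intro ln_mono) auto
    moreover have "ln (exp 1 * (1 / \<alpha>)) = ln (exp 1) + ln (1 / \<alpha>)" using \<alpha>(1) by (intro ln_mult_pos) auto
    ultimately show ?thesis by simp
  qed
  have "pot mu T w - pot mu 0 v =
      (lam * (\<Sum>i<d. - ln (vec_index w i)) - lam * (\<Sum>i<d. - ln (vec_index v i))) +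
      (\<Sum>\<tau>\<in>{1..T}. - ln (ret (Inr \<tau>) w)) + mu / 2 * (ln (vol_det T w) - ln (vol_det 0 v))"
    unfolding pot_eq[OF wp order_refl] pot_eq[OF vp le0] sum_idx
    by (simp add: sum_distrib_left algebra_simps)
  also have "\<dots> \<le> lam * (n * ln (1 / \<alpha>)) + ((\<Sum>\<tau>\<in>{1..T}. - ln (ret (Inr \<tau>) u)) + lam * n) +
      mu / 2 * (n * (4 * ln X))"
    using barrier loss volume params(2) by (intro add_mono mult_left_mono) auto
  also have "\<dots> = (\<Sum>\<tau>\<in>{1..T}. - ln (ret (Inr \<tau>) u)) + lam * n * (1 + ln (1 / \<alpha>)) + 2 * mu * n * ln X"
    by (simp add: algebra_simps)
  also have "\<dots> \<le> (\<Sum>\<tau>\<in>{1..T}. - ln (ret (Inr \<tau>) u)) + lam * n * ln X + 2 * mu * n * ln X"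
    using log ln0 by (intro add_mono mult_left_mono order_refl) auto
  also have "\<dots> = (\<Sum>\<tau>\<in>{1..T}. - ln (ret (Inr \<tau>) u)) + (lam + 2 * mu) * (real d - 1) * ln X"
    by (simp add: dn algebra_simps)
  finally show ?thesis using wo by (auto simp: X_def)
qed

section \<open>The regret\<close>

text \<open>
  The potential is finite at the uniform portfolio, hence also at a minimizer, which therefore has
  positive entries.
\<close>

lemma vb_ftrl_minimizer:
  assumes vb: "vb_ftrl d T lam mu x w" and t: "t \<in> {1..T}"
  shows "w t \<in> open_simplex" and "\<And>u. u \<in> open_simplex \<Longrightarrow> pot mu (t - 1) (w t) \<le> pot mu (t - 1) u"
proof -
  have arg: "is_arg_min (potential d lam mu x (t - 1)) (\<lambda>u. u \<in> std_simplex d) (w t)"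
    using vb t by (auto simp: vb_ftrl_def)
  have pot: "potential d lam mu x (t - 1) u = ereal (pot mu (t - 1) u)" if "u \<in> open_simplex" for u
    using that by (simp add: potential_def pot_def open_simplex_def)
  have ws: "w t \<in> std_simplex d" using arg by (simp add: is_arg_min_def)
  have le: "potential d lam mu x (t - 1) (w t) \<le> potential d lam mu x (t - 1) u" if "u \<in> std_simplex d" for u
    using arg that by (auto simp: is_arg_min_def not_less)
  have "potential d lam mu x (t - 1) (w t) \<le> ereal (pot mu (t - 1) unif)"
    using le[of unif] pot[OF unif_open_simplex] unif_open_simplex by (simp add: open_simplex_def)
  then have "w t \<in> pos_orthant d" by (auto simp: potential_def split: if_splits)
  then show wo: "w t \<in> open_simplex" using ws by (simp add: open_simplex_def)
  show "pot mu (t - 1) (w t) \<le> pot mu (t - 1) u" if "u \<in> open_simplex" for u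
    using le[of u] pot[OF that] pot[OF wo] that by (simp add: open_simplex_def)
qed

text \<open>
  The statement is about all \<open>u\<close>, and not just about a minimizer of \<open>P\<^sub>t\<close>, so that the induction can use it
  for the next iterate \<open>w\<^sub>t\<^sub>+\<^sub>1\<close> while the final round is free to use the comparator.
\<close>

lemma cumulative_loss_le:
  assumes params: "27 / 2 \<le> lam" "8 / 5 * (1 + 16 / (5 * lam))\<^sup>2 \<le> mu" "0 < mu"
    and vb: "vb_ftrl d T lam mu x w" and T1: "1 \<le> T"
  shows "t \<le> T \<Longrightarrow> u \<in> open_simplex \<Longrightarrow>
    (\<Sum>\<tau>\<in>{1..t}. - ln (ret (Inr \<tau>) (w \<tau>))) \<le> pot mu t u - pot mu 0 (w 1)"
proof (induction t arbitrary: u)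
  case 0
  have "1 \<in> {1..T}" using T1 by simp
  from vb_ftrl_minimizer(2)[OF vb this 0(2)] show ?case by simp
next
  case (Suc t)
  have St: "Suc t \<in> {1..T}" using Suc.prems by simp
  note m = vb_ftrl_minimizer[OF vb St]
  have "(\<Sum>\<tau>\<in>{1..t}. - ln (ret (Inr \<tau>) (w \<tau>))) \<le> pot mu t (w (Suc t)) - pot mu 0 (w 1)"
    using Suc.prems by (intro Suc.IH m(1)) simp
  moreover have "pot mu t (w (Suc t)) - ln (ret (Inr (Suc t)) (w (Suc t))) \<le> pot mu (Suc t) u"
    using m(2) by (intro stability[OF params Suc.prems(1) m(1) Suc.prems(2)]) simp
  ultimately show ?case by simp
qed

lemma loss_le_comparator:
  assumes params: "27 / 2 \<le> lam" "8 / 5 * (1 + 16 / (5 * lam))\<^sup>2 \<le> mu" "0 < mu"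
    and vb: "vb_ftrl d T lam mu x w" and T1: "1 \<le> T"
    and u: "u \<in> std_simplex d" "\<And>\<tau>. \<tau> \<in> {1..T} \<Longrightarrow> 0 < ret (Inr \<tau>) u"
  shows "(\<Sum>\<tau>\<in>{1..T}. - ln (ret (Inr \<tau>) (w \<tau>))) \<le>
    (\<Sum>\<tau>\<in>{1..T}. - ln (ret (Inr \<tau>) u)) + (lam + 2 * mu) * (real d - 1) * ln (real T + lam * real d)"
proof (cases "d = 1")
  case True
  have point: "vec_index v 0 = 1" if "v \<in> std_simplex d" for v using that True by (simp add: std_simplex_def)
  have "ret k (w \<tau>) = ret k u" if "\<tau> \<in> {1..T}" for k \<tau>
  proof -
    have "w \<tau> \<in> std_simplex d" using vb_ftrl_minimizer(1)[OF vb that] by (simp add: open_simplex_def)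
    then have eq: "vec_index (w \<tau>) 0 = vec_index u 0" using point u(1) by metis
    show ?thesis unfolding ret_def by (simp add: True eq)
  qed
  then show ?thesis using True by simp
next
  case False
  then have d2: "2 \<le> d" using d_pos by simp
  have w1: "w 1 \<in> open_simplex" using T1 by (intro vb_ftrl_minimizer(1)[OF vb]) simp
  obtain z where z: "z \<in> open_simplex" "pot mu T z - pot mu 0 (w 1) \<le>
      (\<Sum>\<tau>\<in>{1..T}. - ln (ret (Inr \<tau>) u)) + (lam + 2 * mu) * (real d - 1) * ln (real T + lam * real d)"
    using pot_comparator[OF params(1,3) d2 T1 w1 u] by auto
  show ?thesis using cumulative_loss_le[OF params vb T1 order_refl z(1)] z(2) by linarith
qed

lemma regret_le:
  assumes params: "27 / 2 \<le> lam" "8 / 5 * (1 + 16 / (5 * lam))\<^sup>2 \<le> mu" "0 < mu"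
    and vb: "vb_ftrl d T lam mu x w" and T1: "1 \<le> T"
  shows "regret d T w x \<le> ereal ((lam + 2 * mu) * (real d - 1) * ln (real T + lam * real d))"
proof -
  define S where "S = (\<Sum>\<tau>\<in>{1..T}. - ln (ret (Inr \<tau>) (w \<tau>)))"
  define C where "C = (lam + 2 * mu) * (real d - 1) * ln (real T + lam * real d)"
  have loss: "log_loss (x \<tau>) v = (if 0 < ret (Inr \<tau>) v then ereal (- ln (ret (Inr \<tau>) v)) else \<infinity>)"
    if "v \<in> std_simplex d" for \<tau> v
    using that by (simp add: log_loss_def ret_Inr std_simplex_def nonneg_orthant_def)
  have "(\<Sum>\<tau>\<in>{1..T}. log_loss (x \<tau>) (w \<tau>)) = (\<Sum>\<tau>\<in>{1..T}. ereal (- ln (ret (Inr \<tau>) (w \<tau>))))"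
  proof (intro sum.cong refl)
    fix \<tau> assume \<tau>: "\<tau> \<in> {1..T}"
    have wt: "w \<tau> \<in> open_simplex" by (rule vb_ftrl_minimizer(1)[OF vb \<tau>])
    have "Inr \<tau> \<in> idx T" using \<tau> by (auto simp: idx_def)
    then have "0 < ret (Inr \<tau>) (w \<tau>)" using wt ret_pos by (simp add: open_simplex_def)
    then show "log_loss (x \<tau>) (w \<tau>) = ereal (- ln (ret (Inr \<tau>) (w \<tau>)))"
      using wt loss by (simp add: open_simplex_def)
  qed
  also have "\<dots> = ereal S" by (simp add: S_def)
  finally have player: "(\<Sum>\<tau>\<in>{1..T}. log_loss (x \<tau>) (w \<tau>)) = ereal S" .
  have "ereal (S - C) \<le> (INF u\<in>std_simplex d. \<Sum>\<tau>\<in>{1..T}. log_loss (x \<tau>) u)"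
  proof (rule INF_greatest)
    fix u assume u: "u \<in> std_simplex d"
    show "ereal (S - C) \<le> (\<Sum>\<tau>\<in>{1..T}. log_loss (x \<tau>) u)"
    proof (cases "\<forall>\<tau>\<in>{1..T}. 0 < ret (Inr \<tau>) u")
      case True
      have "(\<Sum>\<tau>\<in>{1..T}. log_loss (x \<tau>) u) = ereal (\<Sum>\<tau>\<in>{1..T}. - ln (ret (Inr \<tau>) u))"
        unfolding sum_ereal[symmetric] using True by (intro sum.cong refl) (simp add: loss[OF u])
      then show ?thesis
        using loss_le_comparator[OF params vb T1 u] True by (simp add: S_def C_def)
    next
      case False
      then obtain \<tau> where "\<tau> \<in> {1..T}" "log_loss (x \<tau>) u = \<infinity>" using loss[OF u] by auto
      then have "(\<Sum>\<tau>\<in>{1..T}. log_loss (x \<tau>) u) = \<infinity>" by (subst sum_Pinfty) auto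
      then show ?thesis by simp
    qed
  qed
  then have "ereal S - (INF u\<in>std_simplex d. \<Sum>\<tau>\<in>{1..T}. log_loss (x \<tau>) u) \<le> ereal S - ereal (S - C)"
    by (intro ereal_minus_mono) auto
  then show ?thesis unfolding regret_def player by (simp add: C_def)
qed

end

theorem theorem2p1:
  fixes d T :: nat and x :: "nat \<Rightarrow> real Matrix.vec"
  assumes "d \<ge> 1" and "T \<ge> 1"
    and "\<forall>t\<in>{1..T}. x t \<in> nonneg_orthant d - {0\<^sub>v d}"
  shows "(\<forall>(lam::real) (mu::real) w.
            lam > 0 \<and> mu > 0 \<and> lam \<ge> 2 * exp 1 \<and>
            1 / lam * (1 + 2 * mu / lam)^2 \<le> min (1 / 4) (5 * mu / (8 * (1 + lam))) \<and>
            vb_ftrl d T lam mu x w \<longrightarrow>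
            regret d T w x \<le> ereal ((lam + 2 * mu) * (real d - 1) * ln (real T + lam * real d))) \<and>
         (\<forall>w. vb_ftrl d T 16 7 x w \<longrightarrow>
            regret d T w x \<le> ereal (30 * (real d - 1) * ln (real T + 16 * real d)))"
proof -
  have bound: "regret d T w x \<le> ereal ((lam + 2 * mu) * (real d - 1) * ln (real T + lam * real d))"
    if pos: "0 < lam" "0 < mu" and le: "1 / lam * (1 + 2 * mu / lam)\<^sup>2 \<le> 5 * mu / (8 * (1 + lam))"
      and vb: "vb_ftrl d T lam mu x w" for lam mu w
  proof -
    interpret portfolio d T lam x using assms pos by unfold_locales auto
    show ?thesis by (rule regret_le[OF parameter_bounds[OF pos le] pos(2) vb assms(2)])
  qed
  moreover have "regret d T w x \<le> ereal (30 * (real d - 1) * ln (real T + 16 * real d))"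
    if "vb_ftrl d T 16 7 x w" for w
    using bound[of 16 7 w] that by (simp add: power2_eq_square)
  ultimately show ?thesis by simp
qed

end
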